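(* Let $d\ge 3$, let $h\ge 2$, and let $\mathcal V=\{\mathbf v_1,\mathbf v_2,\mathbf v_3\}\subset\mathbb R^d$ be a set of three linearly independent unit vectors. Let $\mathcal R=\{\mathbf r_1,\ldots,\mathbf r_h\}\subset\mathbb R^d$ be $h$ independent random vectors whose components (with respect to an orthonormal basis) are i.i.d. $\mathcal N(0,1)$, and let $H=H_{\mathcal R,h-1,1}$ be the associated random projection hash. Then the probability of a three-way collision $H(\mathbf v_1)=H(\mathbf v_2)=H(\mathbf v_3)$ equals $$\frac{h}{|V|(2\pi)^{3/2}}\int_{-\infty}^\infty\int_{-\infty}^\infty\int_{-\infty}^\infty G_{\mathcal V}(\lambda_1,\lambda_2,\lambda_3)^{h-1}\exp\!\big(-q_{M^{-1}}(\lambda_1,\lambda_2,\lambda_3)/2\big)\,d\lambda_1\,d\lambda_2\,d\lambda_3,$$ where $V$ is the scalar triple product of $\mathbf v_1,\mathbf v_2,\mathbf v_3$ (computed in the $3$-dimensional space $\mathrm{Span}(\mathcal V)$ with respect to an orthonormal basis), $M$ is the Gram matrix of $\mathcal V$, $q_{M^{-1}}(\lambda_1,\lambda_2,\lambda_3)=\boldsymbol\lambda^T M^{-1}\boldsymbol\lambda$ with $\boldsymbol\lambda=(\lambda_1,\lambda_2,\lambda_3)^T$, and $G_{\mathcal V}(\lambda_1,\lambda_2,\lambda_3)$ is the standard Gaussian mass (on $\mathrm{Span}(\mathcal V)\cong\mathbb R^3$) of the region $\{\mathbf r\in\mathrm{Span}(\mathcal V):|\mathbf r\cdot\mathbf v_n|\ge|\lambda_n|,\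 n=1,2,3\}$, i.e. of the exterior angles at the vertices of the parallelepiped $\{\mathbf r:|\mathbf r\cdot\mathbf v_n|\le|\lambda_n|\ \forall n\}$ whose edges are the dual basis to $\mathcal V$ scaled by the $\lambda_n$. In particular $G_{\mathcal V}(\lambda_1,\lambda_2,\lambda_3)$ can be computed as a single integral over the distance $\rho$ of a point from the origin, namely $G_{\mathcal V}=\int_0^\infty \eta(\rho)f_3(\rho)\,d\rho$, where $\eta(\rho)$ is the proportion of the sphere of radius $\rho$ in $\mathrm{Span}(\mathcal V)$ lying in that region and $f_3$ is the density of the length of a standard $3$-dimensional Gaussian vector.
   Context: Random projection hash: for $\mathcal R=\{\mathbf r_1,\ldots,\mathbf r_h\}\subset\mathbb R^d$ and integers $a,b\ge 0$ with $a+b=h$, $H_{\mathcal R,a,b}(\mathbf v)$ is the set $A\subset\{1,\ldots,h\}$ of size $a$ such that $|\mathbf r_i\cdot\mathbf v|\ge|\mathbf r_j\cdot\mathbf v|$ for all $i\in A$, $j\notin A$ (ties broken in favour of the least index). A $k$-way collision on $\mathbf v_1,\ldots,\mathbf v_k$ means $H(\mathbf v_1)=\cdots=H(\mathbf v_k)$ as sets; probabilities are over the random choice of $\mathcal R$. The dual basis to a linearly independent set $\{\mathbf v_n\}$ in its span is the basis $\{\mathbf u_n\}$ of the span with $\mathbf u_m\cdot\mathbf v_n=\delta_{mn}$. *)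

theory Defs
  imports "HOL-Probability.Probability"
begin

subsection \<open>Random projection hash\<close>

text \<open>
  The vectors \<open>r\<^sub>1, \<dots>, r\<^sub>h\<close> are a family \<open>r :: nat \<Rightarrow> 'a\<close>
  restricted to the indices \<open>{1..h}\<close>.  The relation \<open>beats r v i j\<close> means that \<open>i\<close> is preferred
  to \<open>j\<close> when the indices with the largest \<open>\<bar>r\<^sub>i \<bullet> v\<bar>\<close> are selected, ties being broken in
  favour of the least index.
\<close>

definition beats :: "(nat \<Rightarrow> 'a::real_inner) \<Rightarrow> 'a \<Rightarrow> nat \<Rightarrow> nat \<Rightarrow> bool" where
  "beats r v i j \<longleftrightarrow>
     \<bar>r i \<bullet> v\<bar> > \<bar>r j \<bullet> v\<bar> \<or> (\<bar>r i \<bullet> v\<bar> = \<bar>r j \<bullet> v\<bar> \<and> i < j)"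

definition rp_hash :: "(nat \<Rightarrow> 'a::real_inner) \<Rightarrow> nat \<Rightarrow> nat \<Rightarrow> 'a \<Rightarrow> nat set" where
  "rp_hash r a b v =
     (THE A. A \<subseteq> {1..a+b} \<and> card A = a \<and> (\<forall>i\<in>A. \<forall>j\<in>{1..a+b} - A. beats r v i j))"

lemma beats_trans: "beats r v i j \<Longrightarrow> beats r v j k \<Longrightarrow> beats r v i k"
  unfolding beats_def by auto

lemma beats_asym: "beats r v i j \<Longrightarrow> \<not> beats r v j i"
  unfolding beats_def by auto

lemma beats_total: "i \<noteq> j \<Longrightarrow> beats r v i j \<or> beats r v j i"
  unfolding beats_def by auto

lemma beats_maximum:
  assumes "finite S" "S \<noteq> {}"
  shows "\<exists>m\<in>S. \<forall>j\<in>S - {m}. beats r v m j"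
  using assms
proof (induction S rule: finite_ne_induct)
  case (singleton x)
  then show ?case by simp
next
  case (insert x F)
  then obtain m where m: "m \<in> F" "\<forall>j\<in>F - {m}. beats r v m j" by blast
  show ?case
  proof (cases "beats r v x m")
    case True
    then have "\<forall>j\<in>insert x F - {x}. beats r v x j"
      using m beats_trans[of r v x m] by blast
    then show ?thesis by blast
  next
    case False
    then have "beats r v m x" using beats_total[of x m r v] insert.hyps m(1) by blast
    then show ?thesis using m by blast
  qed
qed

lemma rp_hash_ex1:
  "\<exists>!A. A \<subseteq> {1..a+b} \<and> card A = a \<and> (\<forall>i\<in>A. \<forall>j\<in>{1..a+b} - A. beats r v i j)"
proof (rule ex_ex1I)
  have "n \<le> a + b \<Longrightarrow>
      \<exists>A. A \<subseteq> {1..a+b} \<and> card A = n \<and> (\<forall>i\<in>A. \<forall>j\<in>{1..a+b} - A. beats r v i j)" for n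
  proof (induction n)
    case 0
    show ?case by (rule exI[of _ "{}"]) simp
  next
    case (Suc n)
    then obtain A where A: "A \<subseteq> {1..a+b}" "card A = n"
      "\<forall>i\<in>A. \<forall>j\<in>{1..a+b} - A. beats r v i j" by auto
    have fA: "finite A" using A(1) finite_subset by blast
    have "{1..a+b} - A \<noteq> {}"
    proof
      assume "{1..a+b} - A = {}"
      then have "A = {1..a+b}" using A(1) by blast
      then show False using A(2) Suc.prems by simp
    qed
    then obtain m where m: "m \<in> {1..a+b} - A"
      "\<forall>j\<in>{1..a+b} - A - {m}. beats r v m j"
      using beats_maximum[of "{1..a+b} - A" r v] by blast
    have "insert m A \<subseteq> {1..a+b}" "card (insert m A) = Suc n"
      "\<forall>i\<in>insert m A. \<forall>j\<in>{1..a+b} - insert m A. beats r v i j"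
      using A m fA by auto
    then show ?case by blast
  qed
  from this[of a] show
    "\<exists>A. A \<subseteq> {1..a+b} \<and> card A = a \<and> (\<forall>i\<in>A. \<forall>j\<in>{1..a+b} - A. beats r v i j)"
    by simp
next
  fix A B
  assume A: "A \<subseteq> {1..a+b} \<and> card A = a \<and> (\<forall>i\<in>A. \<forall>j\<in>{1..a+b} - A. beats r v i j)"
    and B: "B \<subseteq> {1..a+b} \<and> card B = a \<and> (\<forall>i\<in>B. \<forall>j\<in>{1..a+b} - B. beats r v i j)"
  have fin: "finite A" "finite B" using A B finite_subset[of _ "{1..a+b}"] by blast+
  show "A = B"
  proof (rule ccontr)
    assume "A \<noteq> B"
    then have "\<not> A \<subseteq> B" "\<not> B \<subseteq> A"
      using card_subset_eq[of B A] card_subset_eq[of A B] fin A B by auto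
    then obtain i j where "i \<in> A" "i \<notin> B" "j \<in> B" "j \<notin> A" by blast
    then have "beats r v i j" "beats r v j i" using A B by auto
    then show False using beats_asym by blast
  qed
qed

subsection \<open>Linear algebra\<close>

definition orthonormal_basis_of :: "('i \<Rightarrow> 'a::real_inner) \<Rightarrow> 'a set \<Rightarrow> bool" where
  "orthonormal_basis_of e S \<longleftrightarrow>
     (\<forall>i j. e i \<bullet> e j = (if i = j then 1 else 0)) \<and> span (range e) = S"

definition coords :: "('i::finite \<Rightarrow> 'a::real_inner) \<Rightarrow> 'a \<Rightarrow> real^'i" where
  "coords e x = (\<chi> i. x \<bullet> e i)"

definition from_coords :: "('i::finite \<Rightarrow> 'a::real_inner) \<Rightarrow> real^'i \<Rightarrow> 'a" where
  "from_coords e x = (\<Sum>i\<in>UNIV. (x $ i) *\<^sub>R e i)"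

definition scalar_triple_product :: "(3 \<Rightarrow> 'a::real_inner) \<Rightarrow> (3 \<Rightarrow> 'a) \<Rightarrow> real" where
  "scalar_triple_product e v =
     coords e (v 1) \<bullet> cross3 (coords e (v 2)) (coords e (v 3))"

definition gram_matrix :: "('i::finite \<Rightarrow> 'a::real_inner) \<Rightarrow> real^'i^'i" where
  "gram_matrix v = (\<chi> m n. v m \<bullet> v n)"

definition quad_form :: "real^'i^'i \<Rightarrow> real^'i::finite \<Rightarrow> real" where
  "quad_form A x = x \<bullet> (A *v x)"

definition is_dual_basis :: "('i \<Rightarrow> 'a::real_inner) \<Rightarrow> ('i \<Rightarrow> 'a) \<Rightarrow> bool" where
  "is_dual_basis u v \<longleftrightarrow>
     inj u \<and> independent (range u) \<and> span (range u) = span (range v) \<and>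
     (\<forall>m n. u m \<bullet> v n = (if m = n then 1 else 0))"

subsection \<open>The parallelepiped and the region outside it\<close>

definition parallelepiped :: "('i \<Rightarrow> 'a::real_inner) \<Rightarrow> real^'i::finite \<Rightarrow> 'a set" where
  "parallelepiped v l = {x \<in> span (range v). \<forall>n. \<bar>x \<bullet> v n\<bar> \<le> \<bar>l $ n\<bar>}"

definition outer_region :: "('i \<Rightarrow> 'a::real_inner) \<Rightarrow> real^'i::finite \<Rightarrow> 'a set" where
  "outer_region v l = {x \<in> span (range v). \<forall>n. \<bar>x \<bullet> v n\<bar> \<ge> \<bar>l $ n\<bar>}"

text \<open>The reflection through the vertex \<open>p\<close> of the (solid) angle that \<open>P\<close> has at \<open>p\<close>.\<close>

definition exterior_angle :: "'a::real_vector set \<Rightarrow> 'a \<Rightarrow> 'a set" where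
  "exterior_angle P p = {p + c *\<^sub>R (p - x) | c x. c \<ge> 0 \<and> x \<in> P}"

subsection \<open>Gaussian mass\<close>

definition std_gaussian :: "(real^'i::finite) measure" where
  "std_gaussian = density lborel (\<lambda>x. \<Prod>i\<in>UNIV. ennreal (std_normal_density (x $ i)))"

definition span_gaussian :: "('i::finite \<Rightarrow> 'a::real_inner) \<Rightarrow> 'a measure" where
  "span_gaussian e = distr std_gaussian borel (from_coords e)"

definition gaussian_mass ::
    "('i::finite \<Rightarrow> 'a::real_inner) \<Rightarrow> ('i \<Rightarrow> 'a) \<Rightarrow> real^'i \<Rightarrow> real" where
  "gaussian_mass e v l = measure (span_gaussian e) (outer_region v l)"

subsection \<open>Proportions of spheres\<close>

text \<open>
  Surface measure on the sphere of radius \<open>\<rho>\<close> about \<open>0\<close>: a cone of height \<open>\<rho>\<close> in dimension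
  \<open>n\<close> has volume \<open>\<rho> / n\<close> times the area of its base.
\<close>

definition sphere_area :: "real \<Rightarrow> 'a::euclidean_space set \<Rightarrow> real" where
  "sphere_area \<rho> E =
     real DIM('a) / \<rho> * measure lborel {t *\<^sub>R x | t x. 0 < t \<and> t \<le> 1 \<and> x \<in> E}"

definition sphere_proportion :: "('i::finite \<Rightarrow> 'a::real_inner) \<Rightarrow> 'a set \<Rightarrow> real \<Rightarrow> real" where
  "sphere_proportion e S \<rho> =
     sphere_area \<rho> {x \<in> sphere (0 :: real^'i) \<rho>. from_coords e x \<in> S} /
     sphere_area \<rho> (sphere (0 :: real^'i) \<rho>)"

definition is_gaussian_length_density :: "'i::finite itself \<Rightarrow> (real \<Rightarrow> real) \<Rightarrow> bool" where
  "is_gaussian_length_density _ f \<longleftrightarrow>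
     (\<forall>\<rho>. 0 \<le> f \<rho>) \<and>
     distributed (std_gaussian :: (real^'i) measure) lborel norm (\<lambda>\<rho>. ennreal (f \<rho>))"

text \<open>Such a density exists in dimension 3.\<close>

lemma distr_lborel_norm_3:
  "distr (lborel :: (real^3) measure) borel norm =
     density lborel (\<lambda>\<rho>. ennreal (indicator {0..} \<rho> * (4 * pi * \<rho>\<^sup>2)))"
    (is "?M = ?N")
proof (rule measure_eqI_generator_eq[where E = "range atMost" and \<Omega> = UNIV
      and A = "\<lambda>i. {..real i}"])
  show "Int_stable (range (atMost :: real \<Rightarrow> real set))"
    by (auto simp: Int_stable_def)
  show "range (atMost :: real \<Rightarrow> real set) \<subseteq> Pow UNIV" by simp
  show "sets ?M = sigma_sets UNIV (range atMost)"
    using arg_cong[OF borel_eq_atMost[where 'a=real], of sets] by simp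
  show "sets ?N = sigma_sets UNIV (range atMost)"
    using arg_cong[OF borel_eq_atMost[where 'a=real], of sets] by simp
  show "range (\<lambda>i. {..real i}) \<subseteq> range atMost" by auto
  show "(\<Union>i. {..real i}) = UNIV"
    using real_arch_simple by auto
  have M: "emeasure ?M {..a} = (if a < 0 then 0 else ennreal (4 / 3 * pi * a ^ 3))" for a
  proof -
    have "emeasure ?M {..a} = emeasure lborel (cball (0 :: real^3) a)"
      by (subst emeasure_distr) (auto simp: cball_def intro!: arg_cong[where f="emeasure lborel"])
    also have "\<dots> = (if a < 0 then 0 else ennreal (4 / 3 * pi * a ^ 3))"
    proof (cases "a < 0")
      case False
      have "unit_ball_vol (real DIM(real^3)) = 4 / 3 * pi"
        using unit_ball_vol_3 by simp
      then show ?thesis using False emeasure_cball[of a "0 :: real^3"] by simp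
    qed simp
    finally show ?thesis .
  qed
  have N: "emeasure ?N {..a} = (if a < 0 then 0 else ennreal (4 / 3 * pi * a ^ 3))" for a :: real
  proof (cases "a < 0")
    case True
    then have "(\<lambda>x. ennreal (indicator {0..} x * (4 * pi * x\<^sup>2)) * indicator {..a} x) = (\<lambda>x. 0)"
      by (intro ext) (simp add: indicator_def)
    then show ?thesis using True by (subst emeasure_density) simp_all
  next
    case False
    have "emeasure ?N {..a} = (\<integral>\<^sup>+ x. ennreal (4 * pi * x\<^sup>2) * indicator {0..a} x \<partial>lborel)"
      by (subst emeasure_density) (auto intro!: nn_integral_cong simp: indicator_def)
    also have "\<dots> = ennreal (4 / 3 * pi * a ^ 3 - 4 / 3 * pi * 0 ^ 3)"
      using False
      by (intro nn_integral_FTC_Icc) (auto intro!: derivative_eq_intros simp: power2_eq_square)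
    finally show ?thesis using False by simp
  qed
  show "emeasure ?M X = emeasure ?N X" if "X \<in> range atMost" for X
    using that M N by auto
  show "emeasure ?M {..real i} \<noteq> \<infinity>" for i
    using M by simp
qed

lemma ex_gaussian_length_density_3: "\<exists>f. is_gaussian_length_density TYPE(3) f"
proof -
  define g where "g \<rho> = exp (- \<rho>\<^sup>2 / 2) / sqrt (2 * pi) ^ 3" for \<rho> :: real
  define f where "f \<rho> = indicator {0..} \<rho> * (4 * pi * \<rho>\<^sup>2) * g \<rho>" for \<rho> :: real
  have g0: "0 \<le> g \<rho>" for \<rho> by (simp add: g_def)
  have [measurable]: "g \<in> borel_measurable borel" unfolding g_def by measurable
  have "(\<Prod>i\<in>UNIV. ennreal (std_normal_density (x $ i))) = ennreal (g (norm x))" for x :: "real^3"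
  proof -
    have "(\<Prod>i\<in>UNIV. std_normal_density (x $ i)) = g (norm x)"
    proof -
      have "(norm x)\<^sup>2 = (\<Sum>i\<in>UNIV. (x $ i)\<^sup>2)"
        by (simp only: power2_norm_eq_inner inner_vec_def) (simp add: power2_eq_square)
      then have "exp (- (norm x)\<^sup>2 / 2) = (\<Prod>i\<in>UNIV. exp (- (x $ i)\<^sup>2 / 2))"
        by (simp add: exp_sum[symmetric] sum_negf sum_divide_distrib)
      then show ?thesis
        by (simp add: g_def std_normal_density_def prod_dividef)
    qed
    then show ?thesis by (simp add: prod_ennreal)
  qed
  then have "distr (std_gaussian :: (real^3) measure) borel norm =
      distr (density lborel (\<lambda>x :: real^3. ennreal (g (norm x)))) borel norm"
    by (simp add: std_gaussian_def)
  also have "\<dots> = density (distr (lborel :: (real^3) measure) borel norm) (\<lambda>\<rho>. ennreal (g \<rho>))"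
    by (rule density_distr[symmetric]) auto
  also have "\<dots> = density lborel (\<lambda>\<rho>. ennreal (f \<rho>))"
    unfolding distr_lborel_norm_3
    by (subst density_density_eq)
       (auto intro!: arg_cong[where f="density lborel"] simp: f_def ennreal_mult[symmetric] g0)
  finally have eq: "distr (std_gaussian :: (real^3) measure) borel norm =
      density lborel (\<lambda>\<rho>. ennreal (f \<rho>))" .
  have "distr (std_gaussian :: (real^3) measure) lborel norm =
      distr (std_gaussian :: (real^3) measure) borel norm"
    by (rule distr_cong) auto
  moreover have [measurable]: "f \<in> borel_measurable borel" unfolding f_def by measurable
  ultimately have "is_gaussian_length_density TYPE(3) f"
    unfolding is_gaussian_length_density_def distributed_def
    using eq g0 by (auto simp: f_def std_gaussian_def)
  then show ?thesis by blast
qed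

end

theory Submission
  imports Defs
begin

text \<open>
  The hash \<open>H\<close> omits exactly one index, the one with the least \<open>\<bar>r\<^sub>i \<bullet> v\<bar>\<close>, so a three-way collision
  means that a single index \<open>j\<close> loses against all the others for each of the \<open>v\<^sub>n\<close>.  These \<open>h\<close> events
  are disjoint.  In an orthonormal basis of the span, the projections of the \<open>r\<^sub>i\<close> are independent
  standard Gaussian vectors in \<open>\<real>\<^sup>3\<close>, because the Gaussian is rotation invariant and its coordinates
  are independent.  Conditioning on the loser, whose inner products with the \<open>v\<^sub>n\<close> are \<open>\<lambda>\<^sub>n\<close>, each of
  the other \<open>h - 1\<close> vectors independently lies in the outer region with probability \<open>G(\<lambda>)\<close>, ties
  being null.  The linear substitution of \<open>\<lambda>\<close> for the projected vector has determinant \<open>V\<close> and turns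
  the squared norm into the quadratic form of the inverse Gram matrix.
\<close>

subsection \<open>Standard Gaussian vectors\<close>

text \<open>The hypothesis gives i.i.d. coordinates with respect to a basis \<open>b\<close> of the
  whole space, while the formula lives in the span of the \<open>v n\<close>. The vectors
  \<open>e\<close> are therefore extended to an orthonormal basis of the whole space indexed by
  \<open>'d\<close> itself; passing from \<open>b\<close> to it is an isometry of
  \<open>real^'d\<close>, and the three coordinates wanted are a marginal. The type
  \<open>'d\<close> is only finite, so the determinant formula used for the last substitution, which
  is stated for well-ordered index types, does not cover this isometry; invariance of Lebesgue
  measure is derived from uniqueness of translation-invariant measures instead. Masses are computed
  as nonnegative integrals, and integrability of the triple integrand is read off from the bound 1
  on a Gaussian average of probabilities. The two geometric claims are independent of the hash. In
  coordinates along the scaled dual basis the parallelepiped is a cube, with one exterior angle for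
  each sign pattern. The radial formula rests on \<open>sphere_area\<close> being a multiple of a
  cone volume: integrating over radii is then Fubini on cones, and no surface measure
  enters.\<close>

lemma borel_measurable_vec_lambda [measurable (raw)]:
  fixes f :: "'i::finite \<Rightarrow> 'w \<Rightarrow> real"
  assumes [measurable]: "\<And>i. f i \<in> borel_measurable M"
  shows "(\<lambda>x. \<chi> i. f i x) \<in> borel_measurable M"
proof (subst borel_measurable_euclidean_space, safe)
  fix b :: "real^'i" assume "b \<in> Basis"
  then obtain i where "b = axis i 1" by (auto simp: Basis_vec_def)
  then show "(\<lambda>x. (\<chi> i. f i x) \<bullet> b) \<in> borel_measurable M"
    by (simp add: inner_axis)
qed

lemma borel_measurable_vec_nth [measurable (raw)]:
  "f \<in> borel_measurable M \<Longrightarrow> (\<lambda>x. f x $ i :: real) \<in> borel_measurable M"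
  by (simp add: cart_eq_inner_axis)

lemma sets_std_gaussian [simp, measurable_cong]: "sets std_gaussian = sets borel"
  by (simp add: std_gaussian_def)

lemma space_std_gaussian [simp]: "space std_gaussian = UNIV"
  by (simp add: std_gaussian_def)

lemma prod_Basis_vec: "(\<Prod>b\<in>(Basis :: (real^'i) set). g b) = (\<Prod>i\<in>UNIV. g (axis i 1))"
proof -
  have B: "(Basis :: (real^'i) set) = (\<lambda>i. axis i 1) ` UNIV"
    by (auto simp: Basis_vec_def)
  show ?thesis
    unfolding B by (subst prod.reindex) (auto simp: inj_on_def axis_eq_axis)
qed

lemma nn_integral_lborel_vec_prod:
  fixes f :: "'i::finite \<Rightarrow> real \<Rightarrow> ennreal"
  assumes [measurable]: "\<And>i. f i \<in> borel_measurable borel"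
  shows "(\<integral>\<^sup>+ x. (\<Prod>i\<in>UNIV. f i (x $ i)) \<partial>(lborel :: (real^'i) measure)) =
    (\<Prod>i\<in>UNIV. \<integral>\<^sup>+ x. f i x \<partial>lborel)"
proof -
  define g where "g b = f (axis_index b)" for b :: "real^'i"
  have "(\<integral>\<^sup>+ x. (\<Prod>b\<in>Basis. g b (x \<bullet> b)) \<partial>(lborel :: (real^'i) measure)) =
    (\<Prod>b\<in>Basis. \<integral>\<^sup>+ x. g b x \<partial>lborel)"
    by (rule nn_integral_lborel_prod) (auto simp: g_def)
  then show ?thesis
    by (simp add: prod_Basis_vec g_def inner_axis)
qed

lemma emeasure_std_gaussian_box:
  fixes A :: "'i::finite \<Rightarrow> real set"
  assumes [measurable]: "\<And>i. A i \<in> sets borel"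
  shows "emeasure std_gaussian {x. \<forall>i. x $ i \<in> A i} =
    (\<Prod>i\<in>UNIV. emeasure (density lborel std_normal_density) (A i))"
proof -
  have "{x :: real^'i. \<forall>i. x $ i \<in> A i} \<in> sets borel" by measurable
  then have "emeasure std_gaussian {x. \<forall>i. x $ i \<in> A i} =
    (\<integral>\<^sup>+ x. (\<Prod>i\<in>UNIV. ennreal (std_normal_density (x $ i))) *
       indicator {x. \<forall>i. x $ i \<in> A i} x \<partial>(lborel :: (real^'i) measure))"
    unfolding std_gaussian_def by (subst emeasure_density) auto
  also have "\<dots> = (\<integral>\<^sup>+ x. (\<Prod>i\<in>UNIV. ennreal (std_normal_density (x $ i)) * indicator (A i) (x $ i))
     \<partial>(lborel :: (real^'i) measure))"
  proof (rule nn_integral_cong)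
    fix x :: "real^'i"
    have "(indicator {x. \<forall>i. x $ i \<in> A i} x :: ennreal) = (\<Prod>i\<in>UNIV. indicator (A i) (x $ i))"
      by (auto simp: indicator_def prod_eq_1_iff)
    then show "(\<Prod>i\<in>UNIV. ennreal (std_normal_density (x $ i))) * indicator {x. \<forall>i. x $ i \<in> A i} x =
      (\<Prod>i\<in>UNIV. ennreal (std_normal_density (x $ i)) * indicator (A i) (x $ i))"
      by (simp add: prod.distrib)
  qed
  also have "\<dots> = (\<Prod>i\<in>UNIV. \<integral>\<^sup>+ x. ennreal (std_normal_density x) * indicator (A i) x \<partial>lborel)"
    by (rule nn_integral_lborel_vec_prod) auto
  also have "\<dots> = (\<Prod>i\<in>UNIV. emeasure (density lborel std_normal_density) (A i))"
    by (subst emeasure_density) auto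
  finally show ?thesis .
qed

lemma emeasure_std_normal_UNIV [simp]: "emeasure (density lborel std_normal_density) UNIV = 1"
  using prob_space.emeasure_space_1[OF prob_space_normal_density[of 1 0]] by simp

lemma prob_space_std_gaussian: "prob_space std_gaussian"
  by (rule prob_spaceI) (use emeasure_std_gaussian_box[of "\<lambda>_. UNIV"] in simp)

text \<open>Lower orthants are closed under intersection and generate the Borel sets, so a finite
  measure is determined by its distribution function.\<close>

lemma measure_eq_atMostI_vec:
  fixes M N :: "(real^'i::finite) measure"
  assumes s: "sets M = sets borel" "sets N = sets borel" and "finite_measure M"
    and eq: "\<And>a. emeasure M {x. \<forall>i. x $ i \<le> a $ i} = emeasure N {x. \<forall>i. x $ i \<le> a $ i}"
  shows "M = N"
proof (rule measure_eqI_generator_eq[where E = "range atMost" and \<Omega> = UNIV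
      and A = "\<lambda>i. {..vec (real i)}"])
  have atM: "{..a} = {x. \<forall>i. x $ i \<le> a $ i}" for a :: "real^'i"
    by (auto simp: less_eq_vec_def)
  have int: "{..a} \<inter> {..b} = {..(\<chi> i. min (a $ i) (b $ i))}" for a b :: "real^'i"
    by (auto simp: less_eq_vec_def)
  show "Int_stable (range (atMost :: real^'i \<Rightarrow> _ set))"
    unfolding Int_stable_def using int by auto
  show "range (atMost :: real^'i \<Rightarrow> _ set) \<subseteq> Pow UNIV" by simp
  show "sets M = sigma_sets UNIV (range atMost)" "sets N = sigma_sets UNIV (range atMost)"
    using s arg_cong[OF borel_eq_atMost[where 'a="real^'i"], of sets] by simp_all
  show "range (\<lambda>i. {..vec (real i) :: real^'i}) \<subseteq> range atMost" by auto
  show "(\<Union>i. {..vec (real i) :: real^'i}) = UNIV"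
  proof (intro set_eqI iffI UNIV_I)
    fix x :: "real^'i"
    obtain k where k: "norm x \<le> real k" using real_arch_simple by blast
    have "x $ i \<le> real k" for i
      using component_le_norm_cart[of x i] k by linarith
    then show "x \<in> (\<Union>i. {..vec (real i)})" by (auto simp: less_eq_vec_def)
  qed
  show "emeasure M X = emeasure N X" if "X \<in> range atMost" for X
    using that eq by (auto simp: atM)
  show "emeasure M {..vec (real i)} \<noteq> \<infinity>" for i
    using finite_measure.emeasure_finite[OF assms(3)] by simp
qed

lemma std_gaussian_marginal:
  fixes k :: "'j::finite \<Rightarrow> 'i::finite"
  assumes "inj k"
  shows "distr std_gaussian borel (\<lambda>x. \<chi> j. x $ k j) = (std_gaussian :: (real^'j) measure)"
proof (rule measure_eq_atMostI_vec)
  interpret prob_space "std_gaussian :: (real^'i) measure" by (rule prob_space_std_gaussian)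
  have m[measurable]: "(\<lambda>x :: real^'i. \<chi> j. x $ k j) \<in> measurable std_gaussian borel"
    by measurable
  show "finite_measure (distr std_gaussian borel (\<lambda>x :: real^'i. \<chi> j. x $ k j))"
    by (rule finite_measure_distr[OF m])
  fix a :: "real^'j"
  \<comment> \<open>Coordinates outside the range of \<open>k\<close> are left unconstrained; they
    contribute the factor 1, so the product over \<open>'i\<close> shrinks to
    \<open>range k\<close>.\<close>
  define A where "A i = (if i \<in> range k then {..a $ inv k i} else UNIV)" for i
  have Aeq: "(\<forall>i. x $ i \<in> A i) \<longleftrightarrow> (\<forall>j. x $ k j \<le> a $ j)" for x :: "real^'i"
  proof (intro iffI allI)
    show "x $ k j \<le> a $ j" if "\<forall>i. x $ i \<in> A i" for j
      using that[rule_format, of "k j"] by (simp add: A_def inv_f_f[OF assms])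
  qed (auto simp: A_def inv_f_f[OF assms])
  have "{x :: real^'j. \<forall>j. x $ j \<le> a $ j} \<in> sets borel" by measurable
  then have "emeasure (distr std_gaussian borel (\<lambda>x :: real^'i. \<chi> j. x $ k j)) {x. \<forall>j. x $ j \<le> a $ j} =
    emeasure std_gaussian {x :: real^'i. \<forall>i. x $ i \<in> A i}"
    by (subst emeasure_distr)
       (auto simp: Aeq intro!: arg_cong[where f="emeasure std_gaussian"])
  also have "\<dots> = (\<Prod>i\<in>UNIV. emeasure (density lborel std_normal_density) (A i))"
    by (rule emeasure_std_gaussian_box) (auto simp: A_def)
  also have "\<dots> = (\<Prod>i\<in>range k. emeasure (density lborel std_normal_density) (A i))"
    by (rule prod.mono_neutral_right) (auto simp: A_def)
  also have "\<dots> = (\<Prod>j\<in>UNIV. emeasure (density lborel std_normal_density) {..a $ j})"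
    by (subst prod.reindex[OF assms]) (simp add: A_def inv_f_f[OF assms])
  also have "\<dots> = emeasure std_gaussian {x. \<forall>j. x $ j \<le> a $ j}"
    using emeasure_std_gaussian_box[of "\<lambda>j. {..a $ j}"] by simp
  finally show "emeasure (distr std_gaussian borel (\<lambda>x :: real^'i. \<chi> j. x $ k j)) {x. \<forall>j. x $ j \<le> a $ j} =
    emeasure std_gaussian {x. \<forall>j. x $ j \<le> a $ j}" .
qed auto

text \<open>Turns the scalar hypotheses into the law of a random vector. The map \<open>k\<close>
  selects the coordinates of one vector from a larger independent family; it is later
  \<open>Pair i\<close>, for the family indexed by pairs.\<close>

lemma (in prob_space) indep_std_normal_imp_std_gaussian:
  fixes X :: "'k \<Rightarrow> 'a \<Rightarrow> real" and k :: "'i::finite \<Rightarrow> 'k"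
  assumes ind: "indep_vars (\<lambda>_. borel) X K" and k: "inj k" "range k \<subseteq> K"
    and X: "\<And>i. distributed M lborel (X (k i)) std_normal_density"
  shows "distr M borel (\<lambda>\<omega>. \<chi> i. X (k i) \<omega>) = std_gaussian"
proof (rule measure_eq_atMostI_vec)
  have [measurable]: "X (k i) \<in> borel_measurable M" for i
    using distributed_measurable[OF X[of i]] by simp
  have m[measurable]: "(\<lambda>\<omega>. \<chi> i. X (k i) \<omega>) \<in> measurable M borel"
    by measurable
  show "finite_measure (distr M borel (\<lambda>\<omega>. \<chi> i. X (k i) \<omega>))"
    by (rule finite_measure_distr[OF m])
  fix a :: "real^'i"
  have "{x :: real^'i. \<forall>j. x $ j \<le> a $ j} \<in> sets borel" by measurable
  then have "emeasure (distr M borel (\<lambda>\<omega>. \<chi> i. X (k i) \<omega>)) {x. \<forall>i. x $ i \<le> a $ i} =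
    emeasure M (\<Inter>p\<in>range k. X p -` {..a $ inv k p} \<inter> space M)"
    by (subst emeasure_distr) (auto simp: inv_f_f[OF k(1)] intro!: arg_cong[where f="emeasure M"])
  also have "\<dots> = (\<Prod>p\<in>range k. emeasure M (X p -` {..a $ inv k p} \<inter> space M))"
    using indep_varsD[OF ind, of "range k" "\<lambda>p. {..a $ inv k p}"] k(2)
    by (simp add: emeasure_eq_measure prod_ennreal)
  also have "\<dots> = (\<Prod>i\<in>UNIV. emeasure M (X (k i) -` {..a $ i} \<inter> space M))"
    by (subst prod.reindex[OF k(1)]) (simp add: inv_f_f[OF k(1)])
  also have "\<dots> = (\<Prod>i\<in>UNIV. emeasure (density lborel std_normal_density) {..a $ i})"
  proof (rule prod.cong[OF refl])
    fix i
    have "emeasure M (X (k i) -` {..a $ i} \<inter> space M) = emeasure (distr M lborel (X (k i))) {..a $ i}"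
      by (subst emeasure_distr) auto
    then show "emeasure M (X (k i) -` {..a $ i} \<inter> space M) =
        emeasure (density lborel std_normal_density) {..a $ i}"
      using distributed_distr_eq_density[OF X[of i]] by simp
  qed
  also have "\<dots> = emeasure std_gaussian {x. \<forall>j. x $ j \<le> a $ j}"
    using emeasure_std_gaussian_box[of "\<lambda>j. {..a $ j}"] by simp
  finally show "emeasure (distr M borel (\<lambda>\<omega>. \<chi> i. X (k i) \<omega>)) {x. \<forall>i. x $ i \<le> a $ i} =
    emeasure std_gaussian {x. \<forall>j. x $ j \<le> a $ j}" .
qed auto

text \<open>Only the norm enters the density. Rotation invariance, the quadratic form in the
  exponent and the radial integral all start from this shape.\<close>

lemma std_gaussian_norm:
  "(std_gaussian :: (real^'i::finite) measure) =
    density lborel (\<lambda>x. ennreal (exp (- (norm x)\<^sup>2 / 2) / sqrt (2 * pi) ^ CARD('i)))"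
proof -
  have "(\<Prod>i\<in>UNIV. ennreal (std_normal_density (x $ i))) =
      ennreal (exp (- (norm x)\<^sup>2 / 2) / sqrt (2 * pi) ^ CARD('i))" for x :: "real^'i"
  proof -
    have "(norm x)\<^sup>2 = (\<Sum>i\<in>UNIV. (x $ i)\<^sup>2)"
      by (simp only: power2_norm_eq_inner inner_vec_def) (simp add: power2_eq_square)
    then have "exp (- (norm x)\<^sup>2 / 2) = (\<Prod>i\<in>UNIV. exp (- (x $ i)\<^sup>2 / 2))"
      by (simp add: exp_sum[symmetric] sum_negf sum_divide_distrib)
    then show ?thesis
      by (simp add: prod_ennreal std_normal_density_def prod_dividef)
  qed
  then show ?thesis by (simp add: std_gaussian_def)
qed

section \<open>Invariance of Lebesgue and Gaussian measure under linear isometries\<close>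

lemma distr_lborel_isometry:
  fixes f :: "'a::euclidean_space \<Rightarrow> 'a"
  assumes f: "linear f" and norm_f: "\<And>x. norm (f x) = norm x"
  shows "distr lborel borel f = lborel"
proof -
  have [measurable]: "f \<in> borel_measurable borel"
    using linear_continuous_on f linear_conv_bounded_linear borel_measurable_continuous_onI by blast
  define N where "N = distr lborel borel f"
  have sN[simp, measurable_cong]: "sets N = sets borel" by (simp add: N_def)
  have inj: "inj f"
    using f norm_f by (metis linear_injective_0 norm_eq_zero)
  then have surj: "surj f" using f linear_injective_imp_surjective by blast
  \<comment> \<open>Since \<open>f\<close> is onto, a shift by \<open>y\<close> of the image is a
    shift by some \<open>z\<close> of the argument, so \<open>N\<close> inherits translation
    invariance from Lebesgue measure.\<close>
  have trans: "(\<integral>\<^sup>+ x. g (x + y) \<partial>N) = (\<integral>\<^sup>+ x. g x \<partial>N)"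
    if [measurable]: "g \<in> borel_measurable borel" for g y
  proof -
    obtain z where y: "y = f z" using surj by auto
    have "(\<integral>\<^sup>+ x. g (x + y) \<partial>N) = (\<integral>\<^sup>+ x. g (f (z + x)) \<partial>lborel)"
      by (simp add: N_def nn_integral_distr y linear_add[OF f] add.commute)
    also have "\<dots> = (\<integral>\<^sup>+ x. g (f x) \<partial>distr lborel borel ((+) z))"
      by (subst nn_integral_distr) auto
    also have "\<dots> = (\<integral>\<^sup>+ x. g x \<partial>N)"
      by (simp add: lborel_distr_plus N_def nn_integral_distr)
    finally show ?thesis .
  qed
  have B: "emeasure N (ball 0 r) = emeasure lborel (ball (0::'a) r)" for r
  proof -
    have "f -` ball 0 r = ball 0 r" using norm_f by auto
    then show ?thesis by (simp add: N_def emeasure_distr)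
  qed
  \<comment> \<open>Needed for exchanging the integrals below. Balls centred at 0 exhaust the space
    and have the same finite mass under \<open>N\<close> as under Lebesgue measure.\<close>
  have "sigma_finite_measure N"
  proof
    have "(\<Union>n. ball (0::'a) (real n)) = UNIV"
    proof -
      have "\<exists>n. norm x < real n" for x :: 'a using reals_Archimedean2 by blast
      then show ?thesis by auto
    qed
    moreover have "emeasure N (ball 0 (real n)) \<noteq> \<infinity>" for n
      using emeasure_lborel_ball_finite[of "0::'a" "real n"] by (simp add: B less_top)
    ultimately show "\<exists>A. countable A \<and> A \<subseteq> sets N \<and> \<Union>A = space N \<and> (\<forall>a\<in>A. emeasure N a \<noteq> \<infinity>)"
      by (intro exI[of _ "range (\<lambda>n. ball 0 (real n))"]) (auto simp: N_def)
  qed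
  then interpret N: sigma_finite_measure N .
  interpret NL: pair_sigma_finite N lborel ..
  let ?B = "ball (0::'a) 1"
  have [measurable]: "?B \<in> sets borel" by (simp add: borel_open)
  \<comment> \<open>Two translation invariant measures are proportional: compare \<open>\<integral>\<integral> 1\<^sub>A(x) 1\<^sub>B(y - x)\<close> in both orders.
    Balls centred at \<open>0\<close> are preserved by \<open>f\<close>, so the factor is \<open>1\<close>.\<close>
  have "emeasure lborel A = emeasure N A" if [measurable]: "A \<in> sets borel" for A
  proof -
    have "emeasure N A * emeasure lborel ?B = (\<integral>\<^sup>+ x. indicator A x * emeasure lborel ?B \<partial>N)"
      by (simp add: nn_integral_multc)
    also have "\<dots> = (\<integral>\<^sup>+ x. \<integral>\<^sup>+ y. indicator A x * indicator ?B y \<partial>lborel \<partial>N)"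
      by (intro nn_integral_cong, subst nn_integral_cmult) auto
    also have "\<dots> = (\<integral>\<^sup>+ x. \<integral>\<^sup>+ y. indicator A x * indicator ?B (y - x) \<partial>lborel \<partial>N)"
    proof (rule nn_integral_cong)
      fix x
      have "(\<integral>\<^sup>+ y. indicator A x * indicator ?B y \<partial>lborel) =
         (\<integral>\<^sup>+ y. indicator A x * indicator ?B y \<partial>distr lborel borel ((+) (- x)))"
        by (simp add: lborel_distr_plus)
      also have "\<dots> = (\<integral>\<^sup>+ y. indicator A x * indicator ?B (y - x) \<partial>lborel)"
        by (subst nn_integral_distr) auto
      finally show "(\<integral>\<^sup>+ y. indicator A x * indicator ?B y \<partial>lborel) = \<dots>" .
    qed
    also have "\<dots> = (\<integral>\<^sup>+ y. \<integral>\<^sup>+ x. indicator A x * indicator ?B (y - x) \<partial>N \<partial>lborel)"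
      by (rule NL.Fubini'[symmetric]) measurable
    also have "\<dots> = (\<integral>\<^sup>+ y. \<integral>\<^sup>+ x. indicator A (x + y) * indicator ?B x \<partial>N \<partial>lborel)"
    proof (rule nn_integral_cong)
      \<comment> \<open>Shifting \<open>x\<close> by \<open>y\<close> turns \<open>y - x\<close>
        into \<open>- x\<close>, and the ball is symmetric about 0.\<close>
      fix y :: 'a
      have "(\<integral>\<^sup>+ x. indicator A x * indicator ?B (y - x) \<partial>N) =
        (\<integral>\<^sup>+ x. indicator A (x + y) * indicator ?B (y - (x + y)) \<partial>N)"
        by (subst trans[symmetric, of _ y]) auto
      also have "\<dots> = (\<integral>\<^sup>+ x. indicator A (x + y) * indicator ?B x \<partial>N)"
        by (intro nn_integral_cong) (auto simp: indicator_def)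
      finally show "(\<integral>\<^sup>+ x. indicator A x * indicator ?B (y - x) \<partial>N) = \<dots>" .
    qed
    also have "\<dots> = (\<integral>\<^sup>+ x. \<integral>\<^sup>+ y. indicator A (x + y) * indicator ?B x \<partial>lborel \<partial>N)"
      by (rule NL.Fubini') measurable
    also have "\<dots> = (\<integral>\<^sup>+ x. \<integral>\<^sup>+ y. indicator A y * indicator ?B x \<partial>distr lborel borel ((+) x) \<partial>N)"
      by (subst nn_integral_distr) auto
    also have "\<dots> = (\<integral>\<^sup>+ x. emeasure lborel A * indicator ?B x \<partial>N)"
      by (simp add: lborel_distr_plus nn_integral_multc)
    also have "\<dots> = emeasure lborel A * emeasure lborel ?B"
      by (simp add: nn_integral_cmult B)
    finally have "emeasure N A * emeasure lborel ?B = emeasure lborel A * emeasure lborel ?B" .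
    moreover have "emeasure lborel ?B \<noteq> 0" "emeasure lborel ?B \<noteq> top"
      using emeasure_lborel_ball_finite[of "0::'a" 1] by (auto simp: emeasure_ball less_imp_neq[OF unit_ball_vol_pos, symmetric])
    ultimately show ?thesis
      using ennreal_mult_cancel_left[of "emeasure lborel ?B"] by (metis mult.commute)
  qed
  then have "N = lborel" by (intro measure_eqI) auto
  then show ?thesis by (simp add: N_def)
qed

lemma std_gaussian_isometry:
  fixes f :: "real^'i::finite \<Rightarrow> real^'i"
  assumes f: "linear f" and norm_f: "\<And>x. norm (f x) = norm x"
  shows "distr std_gaussian borel f = std_gaussian"
proof -
  have [measurable]: "f \<in> borel_measurable borel"
    using linear_continuous_on f linear_conv_bounded_linear borel_measurable_continuous_onI by blast
  let ?g = "\<lambda>x :: real^'i. ennreal (exp (- (norm x)\<^sup>2 / 2) / sqrt (2 * pi) ^ CARD('i))"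
  have "distr std_gaussian borel f = distr (density lborel (\<lambda>x. ?g (f x))) borel f"
    by (simp add: std_gaussian_norm norm_f)
  also have "\<dots> = density (distr lborel borel f) ?g"
    by (rule density_distr[symmetric]) auto
  also have "\<dots> = std_gaussian"
    by (simp add: distr_lborel_isometry[OF assms] std_gaussian_norm)
  finally show ?thesis .
qed

subsection \<open>Collisions\<close>

text \<open>The complement of the candidate set is the singleton of \<open>j\<close>, so the
  defining condition of the hash becomes the right-hand side; uniqueness of the hash gives both
  directions.\<close>

lemma rp_hash_drop_one_iff:
  assumes j: "j \<in> {1..h}"
  shows "rp_hash r (h - 1) 1 v = {1..h} - {j} \<longleftrightarrow> (\<forall>i\<in>{1..h} - {j}. beats r v i j)"
proof -
  \<comment> \<open>The index \<open>j\<close> witnesses that \<open>h\<close> is positive, so the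
    truncated subtraction is exact.\<close>
  have h: "h - 1 + 1 = h" using j by auto
  let ?P = "\<lambda>A. A \<subseteq> {1..h} \<and> card A = h - 1 \<and> (\<forall>i\<in>A. \<forall>k\<in>{1..h} - A. beats r v i k)"
  have ex1: "\<exists>!A. ?P A" using rp_hash_ex1[of "h - 1" 1 r v] unfolding h .
  have "{1..h} - ({1..h} - {j}) = {j}" using j by auto
  then have iff: "?P ({1..h} - {j}) \<longleftrightarrow> (\<forall>i\<in>{1..h} - {j}. beats r v i j)"
    using j by auto
  have H: "rp_hash r (h - 1) 1 v = (THE A. ?P A)" unfolding rp_hash_def h ..
  show ?thesis
    unfolding H iff[symmetric]
  proof
    assume eq: "(THE A. ?P A) = {1..h} - {j}"
    show "?P ({1..h} - {j})" using theI'[OF ex1] unfolding eq .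
  next
    assume "?P ({1..h} - {j})"
    then show "(THE A. ?P A) = {1..h} - {j}" by (rule the1_equality[OF ex1])
  qed
qed

lemma rp_hash_drop_one_ex:
  assumes "h \<ge> 1"
  shows "\<exists>j\<in>{1..h}. rp_hash r (h - 1) 1 v = {1..h} - {j}"
proof -
  have h: "h - 1 + 1 = h" using assms by auto
  let ?A = "rp_hash r (h - 1) 1 v"
  have A: "?A \<subseteq> {1..h}" "card ?A = h - 1"
    using theI'[OF rp_hash_ex1[of "h - 1" 1 r v]] unfolding rp_hash_def h by auto
  have "card ({1..h} - ?A) = 1"
    using A assms by (subst card_Diff_subset) (auto intro: finite_subset)
  then obtain j where "{1..h} - ?A = {j}" by (auto simp: card_1_singleton_iff)
  then have "j \<in> {1..h}" "?A = {1..h} - {j}" using A by auto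
  then show ?thesis by blast
qed

lemma three_way_collision_iff:
  fixes v :: "3 \<Rightarrow> 'a::real_inner"
  assumes "h \<ge> 1"
  shows "rp_hash r (h - 1) 1 (v 1) = rp_hash r (h - 1) 1 (v 2) \<and>
      rp_hash r (h - 1) 1 (v 2) = rp_hash r (h - 1) 1 (v 3) \<longleftrightarrow>
    (\<exists>j\<in>{1..h}. \<forall>n. \<forall>i\<in>{1..h} - {j}. beats r (v n) i j)" (is "?L \<longleftrightarrow> ?R")
proof
  assume L: ?L
  obtain j where "j \<in> {1..h}" "rp_hash r (h - 1) 1 (v 1) = {1..h} - {j}"
    using rp_hash_drop_one_ex[OF assms] by blast
  moreover from this L have "rp_hash r (h - 1) 1 (v n) = {1..h} - {j}" for n
    using exhaust_3[of n] by auto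
  ultimately show ?R using rp_hash_drop_one_iff by metis
next
  assume ?R
  then obtain j where "j \<in> {1..h}" "rp_hash r (h - 1) 1 (v n) = {1..h} - {j}" for n
    using rp_hash_drop_one_iff by metis
  then show ?L by simp
qed

section \<open>Probability that one vector loses in every direction\<close>

text \<open>Once the component \<open>j\<close> is fixed to \<open>x\<close>, the remaining
  conditions cut out a rectangle in the product over \<open>I\<close>, whose mass factorises. The
  relation carries the index \<open>i\<close> because tie-breaking depends on it.\<close>

lemma emeasure_PiM_relative_to_component:
  assumes "prob_space N" and [simp]: "finite I" "j \<notin> I"
    and R: "\<And>i. i \<in> I \<Longrightarrow> Measurable.pred (N \<Otimes>\<^sub>M N) (\<lambda>(x, y). R i x y)"
  shows "emeasure (PiM (insert j I) (\<lambda>_. N)) {f \<in> space (PiM (insert j I) (\<lambda>_. N)). \<forall>i\<in>I. R i (f j) (f i)} =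
    (\<integral>\<^sup>+ x. (\<Prod>i\<in>I. emeasure N {y \<in> space N. R i x y}) \<partial>N)"
proof -
  interpret N: prob_space N by fact
  interpret product_sigma_finite "\<lambda>_. N" ..
  note R[measurable (raw)]
  let ?A = "{f \<in> space (PiM (insert j I) (\<lambda>_. N)). \<forall>i\<in>I. R i (f j) (f i)}"
  have [measurable]: "Measurable.pred (PiM (insert j I) (\<lambda>_. N)) (\<lambda>f. R i (f j) (f i))" if "i \<in> I" for i
  proof -
    have "(\<lambda>f. (f j, f i)) \<in> measurable (PiM (insert j I) (\<lambda>_. N)) (N \<Otimes>\<^sub>M N)"
      using that by (intro measurable_Pair measurable_component_singleton) auto
    from measurable_compose[OF this R[OF that]] show ?thesis by simp
  qed
  have [measurable]: "?A \<in> sets (PiM (insert j I) (\<lambda>_. N))"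
    by measurable
  have "emeasure (PiM (insert j I) (\<lambda>_. N)) ?A = (\<integral>\<^sup>+ f. indicator ?A f \<partial>PiM (insert j I) (\<lambda>_. N))"
    by simp
  also have "\<dots> = (\<integral>\<^sup>+ x. (\<integral>\<^sup>+ f. indicator ?A (f(j := x)) \<partial>PiM I (\<lambda>_. N)) \<partial>N)"
    by (rule product_nn_integral_insert_rev) auto
  also have "\<dots> = (\<integral>\<^sup>+ x. (\<Prod>i\<in>I. emeasure N {y \<in> space N. R i x y}) \<partial>N)"
  proof (rule nn_integral_cong)
    fix x assume x: "x \<in> space N"
    have S: "{y \<in> space N. R i x y} \<in> sets N" if "i \<in> I" for i
    proof -
      have "(\<lambda>y. (x, y)) \<in> measurable N (N \<Otimes>\<^sub>M N)" using x by measurable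
      from measurable_compose[OF this R[OF that]] show ?thesis by simp
    qed
    have "(\<integral>\<^sup>+ f. indicator ?A (f(j := x)) \<partial>PiM I (\<lambda>_. N)) =
      (\<integral>\<^sup>+ f. indicator (\<Pi>\<^sub>E i\<in>I. {y \<in> space N. R i x y}) f \<partial>PiM I (\<lambda>_. N))"
    proof (rule nn_integral_cong)
      fix f assume f: "f \<in> space (PiM I (\<lambda>_. N))"
      then have "f(j := x) \<in> space (PiM (insert j I) (\<lambda>_. N))"
        using x by (auto simp: space_PiM PiE_def extensional_def)
      moreover have "(f(j := x)) i = f i" if "i \<in> I" for i using that \<open>j \<notin> I\<close> by auto
      ultimately show "(indicator ?A (f(j := x)) :: ennreal) =
          indicator (\<Pi>\<^sub>E i\<in>I. {y \<in> space N. R i x y}) f"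
        using f by (auto simp: indicator_def space_PiM PiE_def)
    qed
    also have "\<dots> = emeasure (PiM I (\<lambda>_. N)) (\<Pi>\<^sub>E i\<in>I. {y \<in> space N. R i x y})"
      using S by (intro nn_integral_indicator sets_PiM_I_finite) auto
    also have "\<dots> = (\<Prod>i\<in>I. emeasure N {y \<in> space N. R i x y})"
      using S by (intro emeasure_PiM) auto
    finally show "(\<integral>\<^sup>+ f. indicator ?A (f(j := x)) \<partial>PiM I (\<lambda>_. N)) = \<dots>" .
  qed
  finally show ?thesis .
qed

text \<open>A hyperplane is Lebesgue null, and the Gaussian has a density.\<close>

lemma AE_std_gaussian_inner_neq:
  assumes "a \<noteq> 0"
  shows "AE y in std_gaussian. y \<bullet> a \<noteq> c"
proof -
  have "negligible {y. a \<bullet> y = c}" using assms by (rule negligible_hyperplane[OF disjI1])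
  then have "{y. a \<bullet> y = c} \<in> null_sets lebesgue" by (simp add: negligible_iff_null_sets)
  moreover have "{y. a \<bullet> y = c} \<in> sets lborel"
    using closed_hyperplane[of a c] by auto
  ultimately have "{y. a \<bullet> y = c} \<in> null_sets lborel"
    by (simp add: null_sets_def null_sets_completion_iff)
  then have "AE y in lborel. y \<bullet> a \<noteq> c"
    by (rule AE_I') (auto simp: inner_commute)
  then show ?thesis
    unfolding std_gaussian_def by (subst AE_density) auto
qed

text \<open>Ties occur only on finitely many null hyperplanes, so the outcome \<open>Q\<close> of
  the index comparison does not change the mass.\<close>

lemma emeasure_std_gaussian_beats:
  fixes a :: "'n::finite \<Rightarrow> real^'i::finite"
  assumes "\<And>n. a n \<noteq> 0"
  shows "emeasure std_gaussian {y. \<forall>n. \<bar>l n\<bar> < \<bar>y \<bullet> a n\<bar> \<or> (\<bar>y \<bullet> a n\<bar> = \<bar>l n\<bar> \<and> Q)} =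
    emeasure std_gaussian {y. \<forall>n. \<bar>l n\<bar> \<le> \<bar>y \<bullet> a n\<bar>}"
proof (rule emeasure_eq_AE)
  have "AE y in std_gaussian. \<forall>n\<in>UNIV. y \<bullet> a n \<noteq> l n \<and> y \<bullet> a n \<noteq> - l n"
    using assms AE_std_gaussian_inner_neq by (intro AE_finite_allI) (auto intro: AE_conjI)
  then show "AE y in std_gaussian. (y \<in> {y. \<forall>n. \<bar>l n\<bar> < \<bar>y \<bullet> a n\<bar> \<or> (\<bar>y \<bullet> a n\<bar> = \<bar>l n\<bar> \<and> Q)}) =
      (y \<in> {y. \<forall>n. \<bar>l n\<bar> \<le> \<bar>y \<bullet> a n\<bar>})"
  proof eventually_elim
    case (elim y)
    then have "\<bar>y \<bullet> a n\<bar> \<noteq> \<bar>l n\<bar>" for n by (auto simp: abs_eq_iff)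
    then have "\<bar>l n\<bar> < \<bar>y \<bullet> a n\<bar> \<or> (\<bar>y \<bullet> a n\<bar> = \<bar>l n\<bar> \<and> Q) \<longleftrightarrow> \<bar>l n\<bar> \<le> \<bar>y \<bullet> a n\<bar>" for n
      using less_le[of "\<bar>l n\<bar>" "\<bar>y \<bullet> a n\<bar>"] by metis
    then show ?case by simp
  qed
qed measurable

text \<open>The factor \<open>h\<close> counts the possible losers. Each contributes the same
  integral, because the \<open>W i\<close> have the same law and indices enter otherwise only
  through ties, which are null.\<close>

lemma (in prob_space) emeasure_common_loser:
  fixes W :: "nat \<Rightarrow> 'a \<Rightarrow> real^'i::finite" and a :: "'n::finite \<Rightarrow> real^'i"
  assumes ind: "indep_vars (\<lambda>_. borel) W {1..h}"
    and W: "\<And>i. i \<in> {1..h} \<Longrightarrow> distr M borel (W i) = std_gaussian"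
    and a: "\<And>n. a n \<noteq> 0"
  shows "emeasure M {\<omega> \<in> space M. \<exists>j\<in>{1..h}. \<forall>n. \<forall>i\<in>{1..h} - {j}. beats (\<lambda>i. W i \<omega>) (a n) i j} =
    of_nat h * (\<integral>\<^sup>+ w. emeasure std_gaussian {y. \<forall>n. \<bar>w \<bullet> a n\<bar> \<le> \<bar>y \<bullet> a n\<bar>} ^ (h - 1) \<partial>std_gaussian)"
proof -
  have [measurable]: "W i \<in> borel_measurable M" if "i \<in> {1..h}" for i
    using ind that by (auto simp: indep_vars_def)
  let ?C = "\<lambda>j. {\<omega> \<in> space M. \<forall>n. \<forall>i\<in>{1..h} - {j}. beats (\<lambda>i. W i \<omega>) (a n) i j}"
  let ?G = "\<lambda>w. emeasure std_gaussian {y. \<forall>n. \<bar>w \<bullet> a n\<bar> \<le> \<bar>y \<bullet> a n\<bar>}"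
  define R where "R j i x y \<longleftrightarrow> (\<forall>n. \<bar>x \<bullet> a n\<bar> < \<bar>y \<bullet> a n\<bar> \<or> (\<bar>y \<bullet> a n\<bar> = \<bar>x \<bullet> a n\<bar> \<and> i < j))"
    for i j :: nat and x y
  have C: "?C j \<in> events \<and> emeasure M (?C j) = (\<integral>\<^sup>+ w. ?G w ^ (h - 1) \<partial>std_gaussian)"
    if j: "j \<in> {1..h}" for j
  proof
    have Rm[measurable]: "Measurable.pred (borel \<Otimes>\<^sub>M borel) (\<lambda>(x, y). R j i x y)" for i
      unfolding R_def by measurable
    have Rm'[measurable]: "Measurable.pred M (\<lambda>\<omega>. R j i (W j \<omega>) (W i \<omega>))" if "i \<in> {1..h} - {j}" for i
    proof -
      have "(\<lambda>\<omega>. (W j \<omega>, W i \<omega>)) \<in> measurable M (borel \<Otimes>\<^sub>M borel)"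
        using that j by (intro measurable_Pair) auto
      from measurable_compose[OF this Rm] show ?thesis by simp
    qed
    have CR: "?C j = {\<omega> \<in> space M. \<forall>i\<in>{1..h} - {j}. R j i (W j \<omega>) (W i \<omega>)}"
      by (auto simp: beats_def R_def)
    show "?C j \<in> events" unfolding CR by measurable
    let ?P = "PiM {1..h} (\<lambda>_. borel :: (real^'i) measure)"
    let ?S = "PiM (insert j ({1..h} - {j})) (\<lambda>_. std_gaussian :: (real^'i) measure)"
    \<comment> \<open>The index set is written as an insertion so that the loser \<open>j\<close> is
      the component on which \<open>emeasure_PiM_relative_to_component\<close> conditions.\<close>
    have ins: "insert j ({1..h} - {j}) = {1..h}" using j by auto
    have distr: "distr M ?P (\<lambda>\<omega>. \<lambda>i\<in>{1..h}. W i \<omega>) = ?S"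
    proof -
      have "distr M ?P (\<lambda>\<omega>. \<lambda>i\<in>{1..h}. W i \<omega>) = PiM {1..h} (\<lambda>i. distr M borel (W i))"
        using ind j by (subst indep_vars_iff_distr_eq_PiM'[symmetric]) auto
      also have "\<dots> = ?S" unfolding ins using W by (intro PiM_cong) auto
      finally show ?thesis .
    qed
    have sets: "sets ?S = sets ?P" unfolding ins by (intro sets_PiM_cong) auto
    let ?A = "{f \<in> space ?S. \<forall>i\<in>{1..h} - {j}. R j i (f j) (f i)}"
    have A: "?A \<in> sets ?P"
    proof -
      have "Measurable.pred ?S (\<lambda>f. R j i (f j) (f i))" if "i \<in> {1..h} - {j}" for i
      proof -
        have "(\<lambda>f. (f j, f i)) \<in> measurable ?S (borel \<Otimes>\<^sub>M borel)"
          using that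
          by (intro measurable_Pair measurable_compose[OF measurable_component_singleton]) auto
        from measurable_compose[OF this Rm] show ?thesis by simp
      qed
      then show ?thesis unfolding sets[symmetric] by measurable
    qed
    have m: "(\<lambda>\<omega>. \<lambda>i\<in>{1..h}. W i \<omega>) \<in> measurable M ?P" by measurable
    have "(\<lambda>\<omega>. \<lambda>i\<in>{1..h}. W i \<omega>) -` ?A \<inter> space M = ?C j"
      unfolding CR using j by (auto simp: space_PiM)
    then have "emeasure M (?C j) = emeasure (distr M ?P (\<lambda>\<omega>. \<lambda>i\<in>{1..h}. W i \<omega>)) ?A"
      by (simp only: emeasure_distr[OF m A])
    also have "\<dots> = emeasure ?S ?A" unfolding distr ..
    also have "\<dots> = (\<integral>\<^sup>+ x. (\<Prod>i\<in>{1..h} - {j}. emeasure std_gaussian {y \<in> space std_gaussian. R j i x y}) \<partial>std_gaussian)"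
      by (intro emeasure_PiM_relative_to_component prob_space_std_gaussian) auto
    also have "\<dots> = (\<integral>\<^sup>+ x. (\<Prod>i\<in>{1..h} - {j}. ?G x) \<partial>std_gaussian)"
      using emeasure_std_gaussian_beats[of a, OF a] by (simp add: R_def)
    finally show "emeasure M (?C j) = (\<integral>\<^sup>+ w. ?G w ^ (h - 1) \<partial>std_gaussian)"
      using j by simp
  qed
  have disj: "disjoint_family_on ?C {1..h}"
  proof (unfold disjoint_family_on_def, intro ballI impI)
    fix j k assume "j \<in> {1..h}" "k \<in> {1..h}" "j \<noteq> k"
    \<comment> \<open>Two distinct losers would beat each other in every direction. One direction is
      enough for the contradiction, and \<open>undefined\<close> names some element of
      \<open>'n\<close>.\<close>
    then have False if "\<omega> \<in> ?C j" "\<omega> \<in> ?C k" for \<omega>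
      using that beats_asym[of "\<lambda>i. W i \<omega>" "a undefined" j k] by auto
    then show "?C j \<inter> ?C k = {}" by blast
  qed
  have "{\<omega> \<in> space M. \<exists>j\<in>{1..h}. \<forall>n. \<forall>i\<in>{1..h} - {j}. beats (\<lambda>i. W i \<omega>) (a n) i j} = (\<Union>j\<in>{1..h}. ?C j)"
    by auto
  also have "emeasure M \<dots> = (\<Sum>j\<in>{1..h}. emeasure M (?C j))"
    by (rule sum_emeasure[OF _ disj, symmetric]) (use C in auto)
  also have "\<dots> = of_nat h * (\<integral>\<^sup>+ w. ?G w ^ (h - 1) \<partial>std_gaussian)"
    using C by simp
  finally show ?thesis .
qed

subsection \<open>Orthonormal coordinates\<close>

text \<open>The first half of \<open>orthonormal_basis_of\<close>. The families \<open>e\<close> and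
  \<open>b\<close> span different spaces, so the span is tracked separately.\<close>

definition orthonormal :: "('i \<Rightarrow> 'a::real_inner) \<Rightarrow> bool" where
  "orthonormal e \<longleftrightarrow> (\<forall>i j. e i \<bullet> e j = (if i = j then 1 else 0))"

lemma linear_coords: "linear (coords e)"
  by (intro linearI) (simp_all add: coords_def vec_eq_iff inner_add_left)

lemma linear_from_coords: "linear (from_coords e)"
  by (intro linearI)
     (simp_all add: from_coords_def scaleR_left_distrib sum.distrib scaleR_sum_right)

text \<open>\<open>from_coords e\<close> and \<open>coords e\<close> are adjoint to each other. This
  moves inner products between the space and its coordinates.\<close>

lemma from_coords_inner: "from_coords e x \<bullet> v = x \<bullet> coords e v"
  by (simp add: from_coords_def coords_def inner_vec_def inner_sum_left inner_commute[of v])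

lemma coords_from_coords:
  assumes "orthonormal e"
  shows "coords e (from_coords e x) = x"
proof -
  have ee: "e i \<bullet> e j = (if i = j then 1 else 0)" for i j using assms by (simp add: orthonormal_def)
  show ?thesis
    by (simp add: ee from_coords_def coords_def vec_eq_iff inner_sum_left if_distrib cong: if_cong)
qed

lemma norm_from_coords:
  assumes "orthonormal e"
  shows "norm (from_coords e x) = norm x"
  by (simp add: norm_eq_sqrt_inner from_coords_inner coords_from_coords[OF assms])

lemma from_coords_coords:
  assumes "orthonormal e" "x \<in> span (range e)"
  shows "from_coords e (coords e x) = x"
proof -
  have ee: "e i \<bullet> e j = (if i = j then 1 else 0)" for i j using assms(1) by (simp add: orthonormal_def)
  have "from_coords e (coords e (e i)) = e i" for i
    by (simp add: ee from_coords_def coords_def if_distrib[of "\<lambda>c. c *\<^sub>R _"] cong: if_cong)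
  then have "from_coords e (coords e y) = id y" if "y \<in> range e" for y using that by auto
  moreover have "linear (\<lambda>x. from_coords e (coords e x))"
    using linear_compose[OF linear_coords linear_from_coords] by (simp add: comp_def)
  ultimately have "from_coords e (coords e x) = id x"
    using linear_eq_on_span[OF _ linear_id _ assms(2)] by blast
  then show ?thesis by simp
qed

lemma from_coords_in_span: "from_coords e x \<in> span (range e)"
  unfolding from_coords_def by (intro span_sum span_scale span_base) auto

lemma surj_from_coords:
  fixes e :: "'d::finite \<Rightarrow> real^'d"
  assumes "orthonormal e"
  shows "surj (from_coords e)"
proof -
  have "inj (from_coords e)"
    by (metis inj_onI coords_from_coords[OF assms])
  then show ?thesis by (simp add: linear_injective_imp_surjective linear_from_coords)
qed

lemma norm_coords:
  fixes e :: "'d::finite \<Rightarrow> real^'d"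
  assumes "orthonormal e"
  shows "norm (coords e x) = norm x"
  by (metis surj_from_coords[OF assms] coords_from_coords[OF assms] norm_from_coords[OF assms] surjD)

text \<open>An orthogonal completion is normalised to a basis with as many elements as
  \<open>'d\<close>, hence can be indexed by \<open>'d\<close>, and \<open>k\<close> records where
  the \<open>e i\<close> sit. This indexing makes a change of basis an endomorphism of
  \<open>real^'d\<close>, to which \<open>std_gaussian_isometry\<close> applies.\<close>

lemma orthonormal_extend:
  fixes e :: "'i::finite \<Rightarrow> real^'d::finite"
  assumes e: "orthonormal e"
  obtains e' :: "'d \<Rightarrow> real^'d" and k where "orthonormal e'" "inj k" "\<And>i. e i = e' (k i)"
proof -
  have ee: "e i \<bullet> e j = (if i = j then 1 else 0)" for i j using e by (simp add: orthonormal_def)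
  then have ne: "norm (e i) = 1" for i by (simp add: norm_eq_sqrt_inner)
  have "pairwise orthogonal (range e)"
    by (auto simp: pairwise_def orthogonal_def ee)
  then obtain U where U: "U \<inter> insert 0 (range e) = {}" "pairwise orthogonal (range e \<union> U)"
    "span (range e \<union> U) = span (range e \<union> UNIV)"
    by (rule orthogonal_extension_strong)
  \<comment> \<open>Normalising leaves the \<open>e i\<close> fixed, since they already have norm 1,
    and is legitimate on \<open>U\<close> because \<open>U\<close> avoids 0.\<close>
  define B where "B = (\<lambda>x. x /\<^sub>R norm x) ` (range e \<union> U)"
  have nz: "x \<noteq> 0" if "x \<in> range e \<union> U" for x
  proof -
    have "e i \<noteq> 0" for i using ne[of i] by auto
    then show ?thesis using that U(1) by auto
  qed
  have B1: "norm x = 1" if "x \<in> B" for x using that nz by (auto simp: B_def)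
  have orth: "pairwise orthogonal B"
  proof (rule pairwiseI)
    fix x y assume "x \<in> B" "y \<in> B" "x \<noteq> y"
    then obtain x' y' where "x' \<in> range e \<union> U" "y' \<in> range e \<union> U" "x = x' /\<^sub>R norm x'" "y = y' /\<^sub>R norm y'"
      by (auto simp: B_def)
    moreover from this \<open>x \<noteq> y\<close> have "orthogonal x' y'" by (intro pairwiseD[OF U(2)]) blast+
    ultimately show "orthogonal x y" by (simp add: orthogonal_def)
  qed
  have "0 \<notin> B" using B1 by force
  with orth have indB: "independent B" by (rule pairwise_orthogonal_independent)
  have "range e \<union> U \<subseteq> span B"
  proof
    fix x assume x: "x \<in> range e \<union> U"
    then have "norm x *\<^sub>R (x /\<^sub>R norm x) \<in> span B"
      by (intro span_scale span_base) (auto simp: B_def)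
    then show "x \<in> span B" using nz[OF x] by simp
  qed
  then have "span B = UNIV" using U(3) span_minimal[of "range e \<union> U" "span B"] by auto
  then have "card B = CARD('d)"
    using dim_span_eq_card_independent[OF indB] dim_UNIV[where 'a="real^'d"] by simp
  moreover have "finite B" using indB by (rule independent_imp_finite)
  ultimately obtain e' where e': "bij_betw e' (UNIV :: 'd set) B"
    using finite_same_card_bij[of "UNIV :: 'd set" B] by auto
  have eB: "e i \<in> range e'" for i
  proof -
    have "e i = e i /\<^sub>R norm (e i)" by (simp add: ne)
    then have "e i \<in> B" unfolding B_def by blast
    then show ?thesis using e' by (simp add: bij_betw_def)
  qed
  show thesis
  proof
    show "orthonormal e'"
      unfolding orthonormal_def
    proof (intro allI)
      fix i j
      have "e' i \<in> B" "e' j \<in> B" using e' by (auto simp: bij_betw_def)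
      moreover have "e' i \<noteq> e' j" if "i \<noteq> j" using e' that by (auto simp: bij_betw_def inj_on_def)
      ultimately show "e' i \<bullet> e' j = (if i = j then 1 else 0)"
        using B1 orth by (auto simp: pairwise_def orthogonal_def dot_square_norm)
    qed
    show k: "e i = e' (inv e' (e i))" for i using eB by (simp add: f_inv_into_f)
    show "inj (\<lambda>i. inv e' (e i))"
    proof (rule injI)
      fix i j assume "inv e' (e i) = inv e' (e j)"
      then have "e i = e j" using k by metis
      then show "i = j" using ee[of i j] ee[of i i] by (auto split: if_splits)
    qed
  qed
qed

lemma borel_measurable_linear:
  fixes f :: "'a::euclidean_space \<Rightarrow> 'b::euclidean_space"
  shows "linear f \<Longrightarrow> f \<in> borel_measurable borel"
  by (simp add: borel_measurable_continuous_onI linear_continuous_on linear_conv_bounded_linear)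

text \<open>The map factors through the extended basis \<open>e'\<close>: the change from
  \<open>b\<close> to \<open>e'\<close> is an isometry, and keeping the coordinates at
  \<open>k i\<close> is a marginal.\<close>

lemma distr_std_gaussian_coords:
  fixes e :: "'i::finite \<Rightarrow> real^'d::finite" and b :: "'d \<Rightarrow> real^'d"
  assumes e: "orthonormal e" and b: "orthonormal b"
  shows "distr std_gaussian borel (\<lambda>y. coords e (from_coords b y)) = std_gaussian"
proof -
  obtain e' :: "'d \<Rightarrow> real^'d" and k where e': "orthonormal e'" "inj k" "\<And>i. e i = e' (k i)"
    using orthonormal_extend[OF e] by blast
  let ?f = "coords e' \<circ> from_coords b"
  have lin: "linear ?f" by (intro linear_compose linear_coords linear_from_coords)
  note borel_measurable_linear[OF lin, measurable]
  have "distr std_gaussian borel (\<lambda>y. coords e (from_coords b y)) =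
    distr std_gaussian borel ((\<lambda>x. \<chi> i. x $ k i) \<circ> ?f)"
    by (simp add: coords_def e'(3) comp_def)
  also have "\<dots> = distr (distr std_gaussian borel ?f) borel (\<lambda>x. \<chi> i. x $ k i)"
    by (rule distr_distr[symmetric]) measurable
  also have "distr std_gaussian borel ?f = std_gaussian"
    by (rule std_gaussian_isometry[OF lin]) (simp add: norm_coords[OF e'(1)] norm_from_coords[OF b])
  also have "distr std_gaussian borel (\<lambda>x. \<chi> i. x $ k i) = std_gaussian"
    by (rule std_gaussian_marginal[OF e'(2)])
  finally show ?thesis .
qed

lemma (in prob_space) coords_of_gaussian_family:
  fixes e :: "'i::finite \<Rightarrow> real^'d::finite" and b :: "'d \<Rightarrow> real^'d"
    and r :: "'k \<Rightarrow> 'a \<Rightarrow> real^'d"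
  assumes e: "orthonormal e" and b: "orthonormal b"
    and ind: "indep_vars (\<lambda>_. borel) (\<lambda>(i, c) \<omega>. r i \<omega> \<bullet> b c) (I \<times> UNIV)"
    and r: "\<And>i c. i \<in> I \<Longrightarrow> distributed M lborel (\<lambda>\<omega>. r i \<omega> \<bullet> b c) std_normal_density"
  shows "indep_vars (\<lambda>_. borel) (\<lambda>i \<omega>. coords e (r i \<omega>)) I"
    and "i \<in> I \<Longrightarrow> distr M borel (\<lambda>\<omega>. coords e (r i \<omega>)) = std_gaussian"
proof -
  define Y where "Y i \<omega> = (\<chi> c. r i \<omega> \<bullet> b c)" for i \<omega>
  let ?f = "\<lambda>y. coords e (from_coords b y)"
  have rY: "coords e (r i \<omega>) = ?f (Y i \<omega>)" for i \<omega>
  proof -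
    have "Y i \<omega> = coords b (r i \<omega>)" by (simp add: Y_def coords_def)
    moreover have "from_coords b (coords b (r i \<omega>)) = r i \<omega>"
      by (metis surj_from_coords[OF b] coords_from_coords[OF b] surjD)
    ultimately show ?thesis by simp
  qed
  have "linear (coords e \<circ> from_coords b)" by (intro linear_compose linear_coords linear_from_coords)
  from borel_measurable_linear[OF this] have f[measurable]: "?f \<in> borel_measurable borel"
    by (simp add: comp_def)
  \<comment> \<open>The scalar variables are grouped into disjoint blocks, one for each vector;
    functions of different blocks are independent.\<close>
  have "indep_vars (\<lambda>i. PiM ({i} \<times> UNIV) (\<lambda>_. borel))
      (\<lambda>i \<omega>. restrict (\<lambda>p. (case p of (i, c) \<Rightarrow> \<lambda>\<omega>. r i \<omega> \<bullet> b c) \<omega>) ({i} \<times> UNIV)) I"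
    by (rule indep_vars_restrict[OF ind]) (auto simp: disjoint_family_on_def)
  then have "indep_vars (\<lambda>_. borel)
      (\<lambda>i \<omega>. (\<lambda>g. ?f (\<chi> c. g (i, c))) (restrict (\<lambda>p. (case p of (i, c) \<Rightarrow> \<lambda>\<omega>. r i \<omega> \<bullet> b c) \<omega>) ({i} \<times> UNIV))) I"
    by (rule indep_vars_compose2) measurable
  then show "indep_vars (\<lambda>_. borel) (\<lambda>i \<omega>. coords e (r i \<omega>)) I"
    by (simp add: rY Y_def)
  assume i: "i \<in> I"
  have Y: "distr M borel (Y i) = std_gaussian"
    unfolding Y_def
    using indep_std_normal_imp_std_gaussian[OF ind, of "Pair i"] i r[OF i] by (auto simp: inj_def)
  have [measurable]: "(\<lambda>\<omega>. r i \<omega> \<bullet> b c) \<in> borel_measurable M" for c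
    using distributed_measurable[OF r[OF i]] by simp
  have [measurable]: "Y i \<in> borel_measurable M" unfolding Y_def by measurable
  have "distr M borel (\<lambda>\<omega>. coords e (r i \<omega>)) = distr M borel (?f \<circ> Y i)"
    by (simp add: rY comp_def)
  also have "\<dots> = distr (distr M borel (Y i)) borel ?f"
    by (rule distr_distr[symmetric]) measurable
  finally show "distr M borel (\<lambda>\<omega>. coords e (r i \<omega>)) = std_gaussian"
    unfolding Y distr_std_gaussian_coords[OF e b] .
qed

subsection \<open>Linear substitution\<close>

text \<open>Pushing forward along \<open>T\<close> divides volume by the absolute determinant, and
  the constant density restores it. It suffices to compare boxes, whose preimages are images under
  the inverse \<open>S\<close>.\<close>

lemma lborel_eq_density_distr_linear:
  fixes T :: "real^'n::{finite,wellorder} \<Rightarrow> real^'n::_"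
  assumes T: "linear T" and det: "det (matrix T) \<noteq> 0"
  shows "lborel = density (distr lborel borel T) (\<lambda>_. ennreal \<bar>det (matrix T)\<bar>)"
proof (rule lborel_eqI)
  note borel_measurable_linear[OF T, measurable]
  obtain S where S: "linear S" "T \<circ> S = id" "S \<circ> T = id"
    using T det matrix_invertible[OF T] invertible_det_nz[of "matrix T"] by auto
  then have TS: "T (S x) = x" "S (T x) = x" for x by (auto simp: fun_eq_iff)
  fix l u :: "real^'n::_"
  assume le: "\<And>b. b \<in> Basis \<Longrightarrow> l \<bullet> b \<le> u \<bullet> b"
  have B: "T -` box l u = S ` box l u"
  proof (intro set_eqI iffI)
    fix x assume "x \<in> T -` box l u"
    then have "S (T x) \<in> S ` box l u" by blast
    then show "x \<in> S ` box l u" using TS by simp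
  qed (auto simp: TS)
  have m: "T -` box l u \<in> sets borel"
    using measurable_sets[OF borel_measurable_linear[OF T], of "box l u"] by simp
  have "box l u \<in> lmeasurable" by simp
  then have L: "S ` box l u \<in> lmeasurable" by (rule measurable_linear_image[OF S(1)])
  \<comment> \<open>The box is viewed as the image under \<open>T\<close> of its own preimage, so
    that the determinant of \<open>T\<close> itself appears and not that of
    \<open>S\<close>.\<close>
  have "measure lebesgue (box l u) = measure lebesgue (T ` (S ` box l u))"
    using TS by (simp add: image_image)
  also have "\<dots> = \<bar>det (matrix T)\<bar> * measure lebesgue (S ` box l u)"
    by (rule measure_linear_image[OF T L])
  also have "\<dots> = \<bar>det (matrix T)\<bar> * measure lborel (T -` box l u)"
    using m by (simp add: B[symmetric])
  finally have "measure lborel (box l u) = \<bar>det (matrix T)\<bar> * measure lborel (T -` box l u)"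
    by simp
  moreover have "emeasure lborel (T -` box l u) = ennreal (measure lborel (T -` box l u))"
  proof (rule emeasure_eq_ennreal_measure)
    have "emeasure lebesgue (T -` box l u) < \<infinity>" using L unfolding B[symmetric] fmeasurable_def by blast
    then show "emeasure lborel (T -` box l u) \<noteq> top" using m by simp
  qed
  moreover have "emeasure (density (distr lborel borel T) (\<lambda>_. ennreal \<bar>det (matrix T)\<bar>)) (box l u) =
    ennreal \<bar>det (matrix T)\<bar> * emeasure lborel (T -` box l u)"
    using m by (simp add: emeasure_density_const emeasure_distr)
  ultimately have "emeasure (density (distr lborel borel T) (\<lambda>_. ennreal \<bar>det (matrix T)\<bar>)) (box l u) =
    ennreal (measure lborel (box l u))"
    by (simp add: ennreal_mult)
  then show "emeasure (density (distr lborel borel T) (\<lambda>_. ennreal \<bar>det (matrix T)\<bar>)) (box l u) =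
     (\<Prod>b\<in>Basis. (u - l) \<bullet> b)"
    using le by simp
qed simp

lemma nn_integral_linear_change:
  fixes T :: "real^'n::{finite,wellorder} \<Rightarrow> real^'n::_"
  assumes T: "linear T" and det: "det (matrix T) \<noteq> 0" and [measurable]: "f \<in> borel_measurable borel"
  shows "(\<integral>\<^sup>+ x. f x \<partial>lborel) = ennreal \<bar>det (matrix T)\<bar> * (\<integral>\<^sup>+ x. f (T x) \<partial>lborel)"
proof -
  note borel_measurable_linear[OF T, measurable]
  have "(\<integral>\<^sup>+ x. f x \<partial>lborel) = (\<integral>\<^sup>+ x. f x \<partial>density (distr lborel borel T) (\<lambda>_. ennreal \<bar>det (matrix T)\<bar>))"
    by (subst lborel_eq_density_distr_linear[OF T det]) (rule refl)
  also have "\<dots> = ennreal \<bar>det (matrix T)\<bar> * (\<integral>\<^sup>+ x. f (T x) \<partial>lborel)"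
    by (simp add: nn_integral_density nn_integral_distr nn_integral_cmult)
  finally show ?thesis .
qed

section \<open>Vectors with three entries and iterated integrals\<close>

lemma borel_measurable_vector3 [measurable (raw)]:
  fixes f g h :: "'w \<Rightarrow> real"
  assumes [measurable]: "f \<in> borel_measurable M" "g \<in> borel_measurable M" "h \<in> borel_measurable M"
  shows "(\<lambda>x. vector [f x, g x, h x] :: real^3) \<in> borel_measurable M"
proof -
  have "(\<lambda>x. vector [f x, g x, h x] :: real^3) =
      (\<lambda>x. \<chi> i. if i = 1 then f x else if i = 2 then g x else h x)"
    by (simp add: fun_eq_iff vec_eq_iff forall_3)
  then show ?thesis by simp
qed

lemma measurable_vector3_case_prod [measurable]:
  "(\<lambda>(x, y, z). vector [x, y, z] :: real^3) \<in> borel_measurable (borel :: (real \<times> real \<times> real) measure)"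
proof -
  have "(\<lambda>p :: real \<times> real \<times> real. vector [fst p, fst (snd p), snd (snd p)] :: real^3) \<in> borel_measurable borel"
    by (intro borel_measurable_vector3 borel_measurable_continuous_onI continuous_intros)
  then show ?thesis by (simp add: case_prod_unfold)
qed

text \<open>The bridge between \<open>real^3\<close>, where the linear substitution takes place, and
  the product space underlying the iterated integral.\<close>

lemma lborel_vector3:
  "distr (lborel :: (real \<times> real \<times> real) measure) borel (\<lambda>(x, y, z). vector [x, y, z]) =
    (lborel :: (real^3) measure)"
proof (rule lborel_eqI[symmetric])
  fix l u :: "real^3"
  assume "\<And>b. b \<in> Basis \<Longrightarrow> l \<bullet> b \<le> u \<bullet> b"
  then have le: "l $ i \<le> u $ i" for i
    by (metis axis_in_Basis_iff inner_axis real_inner_1_right Basis_real_def insertI1)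
  have times: "emeasure lborel (A \<times> B) = emeasure lborel A * emeasure lborel B"
    if "A \<in> sets borel" "B \<in> sets borel" for A :: "'a::euclidean_space set" and B :: "'b::euclidean_space set"
    using lborel.emeasure_pair_measure_Times[of A lborel B] that by (simp add: lborel_prod)
  let ?B = "box (l $ 1) (u $ 1) \<times> box (l $ 2) (u $ 2) \<times> box (l $ 3) (u $ 3)"
  have "emeasure (distr lborel borel (\<lambda>(x, y, z). vector [x, y, z] :: real^3)) (box l u) = emeasure lborel ?B"
    by (subst emeasure_distr) (auto simp: mem_box_cart forall_3 intro!: arg_cong[where f="emeasure lborel"])
  also have "\<dots> = ennreal (u $ 1 - l $ 1) * (ennreal (u $ 2 - l $ 2) * ennreal (u $ 3 - l $ 3))"
    using le times[of "box (l $ 2) (u $ 2)" "box (l $ 3) (u $ 3)"]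
    by (subst times) (auto intro: borel_Times)
  also have "\<dots> = ennreal ((u $ 1 - l $ 1) * ((u $ 2 - l $ 2) * (u $ 3 - l $ 3)))"
    using le[of 1] le[of 2] le[of 3] by (simp only: ennreal_mult mult_nonneg_nonneg diff_ge_0_iff_ge)
  also have "(u $ 1 - l $ 1) * ((u $ 2 - l $ 2) * (u $ 3 - l $ 3)) = (\<Prod>b\<in>Basis. (u - l) \<bullet> b)"
    unfolding prod_Basis_vec UNIV_3 by (simp add: inner_axis)
  finally show "emeasure (distr lborel borel (\<lambda>(x, y, z). vector [x, y, z] :: real^3)) (box l u) =
    (\<Prod>b\<in>Basis. (u - l) \<bullet> b)" .
qed simp

lemma integral_iterated_3:
  fixes f :: "real \<Rightarrow> real \<Rightarrow> real \<Rightarrow> real"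
  assumes "integrable lborel (\<lambda>(x, y, z). f x y z)"
  shows "(\<integral>z. (\<integral>y. (\<integral>x. f x y z \<partial>lborel) \<partial>lborel) \<partial>lborel) = (\<integral>(x, y, z). f x y z \<partial>lborel)"
proof -
  have f: "integrable (lborel \<Otimes>\<^sub>M lborel) (\<lambda>(x, p). f x (fst p) (snd p))"
    using assms by (simp add: lborel_prod case_prod_unfold)
  have "integrable (lborel \<Otimes>\<^sub>M lborel) (\<lambda>(y, z). \<integral>x. f x y z \<partial>lborel)"
    using lborel_pair.integrable_snd[OF f] by (simp add: lborel_prod case_prod_unfold)
  then have "(\<integral>z. (\<integral>y. (\<integral>x. f x y z \<partial>lborel) \<partial>lborel) \<partial>lborel) =
      (\<integral>p. (\<integral>x. f x (fst p) (snd p) \<partial>lborel) \<partial>lborel)"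
    by (subst lborel_pair.integral_snd) (simp_all add: lborel_prod case_prod_unfold)
  also have "\<dots> = (\<integral>(x, y, z). f x y z \<partial>lborel)"
    using lborel_pair.integral_snd[OF f] by (simp add: lborel_prod case_prod_unfold)
  finally show ?thesis .
qed

section \<open>Gram matrix, quadratic form and triple product in coordinates\<close>

lemma gram_matrix_coords:
  assumes e: "orthonormal e" and v: "\<And>n. v n \<in> span (range e)"
  shows "gram_matrix v = (\<chi> n. coords e (v n)) ** transpose (\<chi> n. coords e (v n))"
proof -
  have "v m \<bullet> v n = coords e (v m) \<bullet> coords e (v n)" for m n
    using from_coords_inner[of e "coords e (v m)" "v n"] from_coords_coords[OF e v] by simp
  then show ?thesis
    by (simp add: gram_matrix_def vec_eq_iff matrix_matrix_mult_def transpose_def inner_vec_def)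
qed

lemma matrix_inv_inverse:
  assumes "invertible A"
  shows "A ** matrix_inv A = mat 1" "matrix_inv A ** A = mat 1"
  using someI_ex[OF assms[unfolded invertible_def]] unfolding matrix_inv_def by auto

lemma quad_form_matrix_inv_gram:
  fixes A :: "real^'n::finite^'n"
  assumes "det A \<noteq> 0"
  shows "quad_form (matrix_inv (A ** transpose A)) (A *v w) = (norm w)\<^sup>2"
proof -
  let ?G = "A ** transpose A"
  have inv: "invertible ?G" "invertible (transpose A)"
    using assms by (simp_all add: invertible_det_nz det_mul)
  \<comment> \<open>The vector \<open>z\<close> solves the linear system of the Gram matrix with
    right-hand side \<open>A *v w\<close>, so the inverse of a product need not be expanded.\<close>
  define z where "z = matrix_inv (transpose A) *v w"
  have z: "transpose A *v z = w"
    by (simp add: z_def matrix_vector_mul_assoc matrix_inv_inverse(1)[OF inv(2)])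
  have "A *v w = ?G *v z"
    using matrix_vector_mul_assoc[of A "transpose A" z] unfolding z .
  then have "matrix_inv ?G *v (A *v w) = z"
    by (simp only: matrix_vector_mul_assoc[of "matrix_inv ?G"] matrix_inv_inverse(2)[OF inv(1)] matrix_vector_mul_lid)
  then have "quad_form (matrix_inv ?G) (A *v w) = (A *v w) \<bullet> z"
    by (simp add: quad_form_def)
  also have "\<dots> = w \<bullet> (transpose A *v z)"
    by (metis dot_lmul_matrix inner_commute transpose_matrix_vector)
  finally show ?thesis by (simp only: z power2_norm_eq_inner)
qed

text \<open>A kernel vector yields a point of the common span orthogonal to every
  \<open>v n\<close>, hence orthogonal to itself, hence 0.\<close>

lemma det_coords_nonzero:
  fixes v :: "'n::finite \<Rightarrow> 'a::real_inner"
  assumes e: "orthonormal e" and span: "span (range e) = span (range v)"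
  shows "det (\<chi> n. coords e (v n)) \<noteq> 0"
proof -
  let ?A = "\<chi> n. coords e (v n)"
  have "x = 0" if x: "?A *v x = 0" for x
  proof -
    have "x \<bullet> coords e (v n) = 0" for n
      using arg_cong[OF x, of "\<lambda>y. y $ n"] by (simp add: matrix_vector_mult_def inner_vec_def mult.commute)
    then have "orthogonal (from_coords e x) y" if "y \<in> range v" for y
      using that by (auto simp: from_coords_inner orthogonal_def)
    then have "orthogonal (from_coords e x) y" if "y \<in> span (range v)" for y
      by (rule orthogonal_to_span[OF that])
    then have "from_coords e x \<bullet> from_coords e x = 0"
      using from_coords_in_span[of e x] span by (simp add: orthogonal_def)
    then show "x = 0" using norm_from_coords[OF e, of x] by simp
  qed
  then have "inj ((*v) ?A)"
    by (subst linear_injective_0) auto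
  then show ?thesis
    by (metis invertible_det_nz invertible_left_inverse matrix_left_invertible_injective)
qed

lemma scalar_triple_product_det:
  "scalar_triple_product e v = det (\<chi> n. coords e (v n))"
proof -
  have "(\<chi> n. coords e (v n)) = vector [coords e (v 1), coords e (v 2), coords e (v 3)]"
    by (simp add: vec_eq_iff forall_3)
  then show ?thesis by (simp add: scalar_triple_product_def dot_cross_det)
qed

section \<open>Gaussian mass of the outer region as a function of its parameters\<close>

lemma outer_region_closed:
  fixes v :: "'i::finite \<Rightarrow> 'a::euclidean_space"
  shows "closed (outer_region v l)"
proof -
  have "outer_region v l = span (range v) \<inter> (\<Inter>n. {x. \<bar>l $ n\<bar> \<le> \<bar>x \<bullet> v n\<bar>})"
    by (auto simp: outer_region_def)
  then show ?thesis
    by (simp add: closed_subspace closed_Collect_le continuous_intros closed_Int closed_INT)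
qed

lemma from_coords_in_outer_region:
  assumes "span (range e) = span (range v)"
  shows "from_coords e y \<in> outer_region v l \<longleftrightarrow> (\<forall>n. \<bar>l $ n\<bar> \<le> \<bar>y \<bullet> coords e (v n)\<bar>)"
  using from_coords_in_span[of e y] assms by (simp add: outer_region_def from_coords_inner)

lemma gaussian_mass_eq:
  fixes v :: "'i::finite \<Rightarrow> 'a::euclidean_space"
  assumes "span (range e) = span (range v)"
  shows "gaussian_mass e v l = measure std_gaussian {y. \<forall>n. \<bar>l $ n\<bar> \<le> \<bar>y \<bullet> coords e (v n)\<bar>}"
proof -
  have m: "from_coords e \<in> measurable std_gaussian borel"
    using borel_measurable_linear[OF linear_from_coords[of e]] by simp
  have "outer_region v l \<in> sets borel" by (rule borel_closed[OF outer_region_closed])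
  then have "gaussian_mass e v l =
      measure std_gaussian (from_coords e -` outer_region v l \<inter> space std_gaussian)"
    unfolding gaussian_mass_def span_gaussian_def by (rule measure_distr[OF m])
  also have "from_coords e -` outer_region v l \<inter> space std_gaussian =
      {y. \<forall>n. \<bar>l $ n\<bar> \<le> \<bar>y \<bullet> coords e (v n)\<bar>}"
    using from_coords_in_outer_region[OF assms] by auto
  finally show ?thesis .
qed

lemma emeasure_std_gaussian_eq: "emeasure std_gaussian A = ennreal (measure std_gaussian A)"
  using finite_measure.emeasure_eq_measure[OF prob_space.finite_measure[OF prob_space_std_gaussian]] .

text \<open>The mass at \<open>l\<close> is that of a section of a set jointly measurable in
  \<open>l\<close> and \<open>y\<close>.\<close>

lemma borel_measurable_gaussian_mass:
  fixes v :: "'i::finite \<Rightarrow> 'a::euclidean_space"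
  assumes "span (range e) = span (range v)"
  shows "gaussian_mass e v \<in> borel_measurable borel"
proof -
  interpret prob_space "std_gaussian :: (real^'i) measure" by (rule prob_space_std_gaussian)
  have "(\<lambda>l :: real^'i. emeasure std_gaussian {y. \<forall>n. \<bar>l $ n\<bar> \<le> \<bar>y \<bullet> coords e (v n)\<bar>}) \<in> borel_measurable borel"
  proof (rule measurable_emeasure)
    have "{p \<in> space (borel \<Otimes>\<^sub>M borel). \<forall>n. \<bar>(fst p :: real^'i) $ n\<bar> \<le> \<bar>snd p \<bullet> coords e (v n)\<bar>}
        \<in> sets (borel \<Otimes>\<^sub>M borel)"
      by measurable
    then show "{p \<in> space (borel \<Otimes>\<^sub>M std_gaussian).
        snd p \<in> {y. \<forall>n. \<bar>(fst p :: real^'i) $ n\<bar> \<le> \<bar>y \<bullet> coords e (v n)\<bar>}}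
        \<in> sets (borel \<Otimes>\<^sub>M std_gaussian)"
      by (simp add: space_pair_measure cong: sets_pair_measure_cong)
  qed simp
  then have "(\<lambda>l :: real^'i. enn2real (emeasure std_gaussian {y. \<forall>n. \<bar>l $ n\<bar> \<le> \<bar>y \<bullet> coords e (v n)\<bar>})) \<in> borel_measurable borel"
    by measurable
  then show ?thesis
    using gaussian_mass_eq[OF assms] by (simp add: measure_def[symmetric] cong: measurable_cong)
qed

lemma borel_measurable_quad_form:
  fixes B :: "real^'i::finite^'i"
  shows "quad_form B \<in> borel_measurable borel"
proof -
  have "(\<lambda>x. B *v x) \<in> borel_measurable borel"
    by (rule borel_measurable_linear[OF matrix_vector_mul_linear])
  then show ?thesis unfolding quad_form_def[abs_def] by measurable
qed

text \<open>The substitution is \<open>l = A *v w\<close>, where the rows of \<open>A\<close> are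
  the coordinates of the \<open>v n\<close>; thus \<open>A *v w\<close> lists the inner products of
  \<open>w\<close> with them, and the exponent becomes the squared norm of \<open>w\<close>. The
  Gaussian normalisation and the Jacobian make up the denominator.\<close>

lemma gaussian_mass_power_expectation:
  fixes v :: "'n::{finite,wellorder} \<Rightarrow> 'a::euclidean_space" and m :: nat
  assumes e: "orthonormal e" and span: "span (range e) = span (range v)"
  defines "D \<equiv> \<bar>det (\<chi> n. coords e (v n))\<bar>"
    and "F \<equiv> \<lambda>l. gaussian_mass e v l ^ m * exp (- quad_form (matrix_inv (gram_matrix v)) l / 2)"
  shows "integrable lborel F"
    and "(\<integral>\<^sup>+ w. emeasure std_gaussian {y. \<forall>n. \<bar>w \<bullet> coords e (v n)\<bar> \<le> \<bar>y \<bullet> coords e (v n)\<bar>} ^ m \<partial>std_gaussian) =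
      ennreal ((\<integral>l. F l \<partial>lborel) / (D * sqrt (2 * pi) ^ CARD('n)))" (is "?E = _")
proof -
  interpret S: prob_space "std_gaussian :: (real^'n::_) measure" by (rule prob_space_std_gaussian)
  define A where "A = (\<chi> n. coords e (v n))"
  define C where "C = sqrt (2 * pi) ^ CARD('n)"
  have C: "C > 0" by (simp add: C_def)
  have detA: "det A \<noteq> 0" unfolding A_def by (rule det_coords_nonzero[OF e span])
  then have D: "D > 0" "D = \<bar>det (matrix ((*v) A))\<bar>" by (simp_all add: D_def A_def[symmetric])
  have "v n \<in> span (range e)" for n unfolding span by (simp add: span_base)
  then have gram: "gram_matrix v = A ** transpose A"
    unfolding A_def by (rule gram_matrix_coords[OF e])
  note borel_measurable_gaussian_mass[OF span, measurable]
    borel_measurable_quad_form[measurable]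
    borel_measurable_linear[OF matrix_vector_mul_linear, measurable]
  have [measurable]: "F \<in> borel_measurable borel" unfolding F_def by measurable
  have F0: "F l \<ge> 0" for l by (simp add: F_def gaussian_mass_def)
  have F: "F (A *v w) = gaussian_mass e v (A *v w) ^ m * exp (- (norm w)\<^sup>2 / 2)" for w
    by (simp only: F_def gram quad_form_matrix_inv_gram[OF detA])
  have mass: "emeasure std_gaussian {y. \<forall>n. \<bar>w \<bullet> coords e (v n)\<bar> \<le> \<bar>y \<bullet> coords e (v n)\<bar>} =
      ennreal (gaussian_mass e v (A *v w))" for w
  proof -
    have "(A *v w) $ n = w \<bullet> coords e (v n)" for n
      by (simp add: A_def matrix_vector_mult_def inner_vec_def mult.commute)
    then show ?thesis by (simp add: gaussian_mass_eq[OF span] emeasure_std_gaussian_eq)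
  qed
  let ?I = "\<integral>\<^sup>+ w. ennreal (F (A *v w)) \<partial>lborel"
  have "?E = (\<integral>\<^sup>+ w. ennreal (gaussian_mass e v (A *v w)) ^ m \<partial>std_gaussian)"
    by (simp only: mass)
  also have "\<dots> = (\<integral>\<^sup>+ w. ennreal (exp (- (norm w)\<^sup>2 / 2) / C) * ennreal (gaussian_mass e v (A *v w)) ^ m \<partial>lborel)"
    unfolding std_gaussian_norm C_def[symmetric] by (subst nn_integral_density) auto
  also have "\<dots> = (\<integral>\<^sup>+ w. ennreal (1 / C) * ennreal (F (A *v w)) \<partial>lborel)"
    using C by (intro nn_integral_cong)
      (simp add: F ennreal_power ennreal_mult[symmetric] gaussian_mass_def field_simps)
  also have "\<dots> = ennreal (1 / C) * ?I"
    by (subst nn_integral_cmult) auto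
  finally have E: "?E = ennreal (1 / C) * ?I" .
  \<comment> \<open>The integrand is a power of a probability, so the average is at most 1. This
    finiteness is the source of integrability of \<open>F\<close>.\<close>
  have "?E \<le> (\<integral>\<^sup>+ w. 1 \<partial>(std_gaussian :: (real^'n::_) measure))"
    by (intro nn_integral_mono power_le_one) (auto simp: S.emeasure_le_1)
  then have "?E < top" using S.emeasure_space_1 by (simp add: le_less_trans[OF _ ennreal_one_less_top])
  then have "?I < top" using C unfolding E by (auto simp: ennreal_mult_less_top)
  \<comment> \<open>The factor \<open>D\<close> appears on the side of the integral over
    \<open>w\<close>; solving for that integral moves it into the denominator.\<close>
  moreover have nn: "(\<integral>\<^sup>+ l. ennreal (F l) \<partial>lborel) = ennreal D * ?I"
    unfolding D(2) using detA
    by (intro nn_integral_linear_change[OF matrix_vector_mul_linear]) auto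
  ultimately have "(\<integral>\<^sup>+ l. ennreal (F l) \<partial>lborel) < top" by (simp add: ennreal_mult_less_top)
  then show int: "integrable lborel F"
    using F0 by (intro integrableI_bounded) (auto simp: abs_of_nonneg)
  have "ennreal (\<integral>l. F l \<partial>lborel) = ennreal D * ?I"
    using nn nn_integral_eq_integral[OF int] F0 by simp
  moreover have "?I = ennreal (1 / D) * (ennreal D * ?I)"
    using D(1) by (simp add: mult.assoc[symmetric] ennreal_mult[symmetric])
  ultimately have "?I = ennreal (1 / D) * ennreal (\<integral>l. F l \<partial>lborel)" by simp
  then show "?E = ennreal ((\<integral>l. F l \<partial>lborel) / (D * sqrt (2 * pi) ^ CARD('n)))"
    unfolding E C_def[symmetric] using C D(1) F0
    by (simp add: ennreal_mult[symmetric] integral_nonneg mult.commute)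
qed

lemma integral_vector3:
  fixes F :: "real^3 \<Rightarrow> real"
  assumes F: "integrable lborel F"
  shows "integrable lborel (\<lambda>(x, y, z). F (vector [x, y, z]))"
    and "(\<integral>z. (\<integral>y. (\<integral>x. F (vector [x, y, z]) \<partial>lborel) \<partial>lborel) \<partial>lborel) = (\<integral>l. F l \<partial>lborel)"
proof -
  have eq: "(\<lambda>(x, y, z). F (vector [x, y, z])) = (\<lambda>p. F (case p of (x, y, z) \<Rightarrow> vector [x, y, z]))"
    by auto
  have m: "(\<lambda>(x, y, z). vector [x, y, z] :: real^3) \<in> measurable lborel borel" by simp
  have Fm: "F \<in> borel_measurable borel" using borel_measurable_integrable[OF F] by simp
  show int: "integrable lborel (\<lambda>(x, y, z). F (vector [x, y, z]))"
    unfolding eq using F by (subst integrable_distr_eq[OF m Fm, symmetric]) (simp add: lborel_vector3)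
  have "(\<integral>z. (\<integral>y. (\<integral>x. F (vector [x, y, z]) \<partial>lborel) \<partial>lborel) \<partial>lborel) =
      (\<integral>(x, y, z). F (vector [x, y, z]) \<partial>lborel)"
    by (rule integral_iterated_3[OF int])
  also have "\<dots> = (\<integral>l. F l \<partial>lborel)"
    unfolding eq by (subst integral_distr[OF m Fm, symmetric]) (simp add: lborel_vector3)
  finally show "(\<integral>z. (\<integral>y. (\<integral>x. F (vector [x, y, z]) \<partial>lborel) \<partial>lborel) \<partial>lborel) = (\<integral>l. F l \<partial>lborel)" .
qed

subsection \<open>Exterior angles of the parallelepiped\<close>

text \<open>Both sides are linear in \<open>x\<close> and agree on the \<open>u m\<close>, which
  span.\<close>

lemma dual_basis_expansion:
  fixes u v :: "'i::finite \<Rightarrow> 'a::real_inner"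
  assumes "is_dual_basis u v" and x: "x \<in> span (range v)"
  shows "x = (\<Sum>n\<in>UNIV. (x \<bullet> v n) *\<^sub>R u n)"
proof -
  have span: "span (range u) = span (range v)" and dual: "u m \<bullet> v n = (if m = n then 1 else 0)" for m n
    using assms(1) by (auto simp: is_dual_basis_def)
  have eq: "id y = (\<Sum>n\<in>UNIV. (y \<bullet> v n) *\<^sub>R u n)" if "y \<in> range u" for y
  proof -
    obtain m where "y = u m" using \<open>y \<in> range u\<close> by blast
    then show ?thesis by (simp add: dual if_distrib[of "\<lambda>c. c *\<^sub>R _"] cong: if_cong)
  qed
  have lin: "linear (\<lambda>y. \<Sum>n\<in>UNIV. (y \<bullet> v n) *\<^sub>R u n)"
    by (intro linearI) (simp_all add: inner_add_left scaleR_left_distrib sum.distrib scaleR_sum_right)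
  have "id x = (\<Sum>n\<in>UNIV. (x \<bullet> v n) *\<^sub>R u n)"
    by (rule linear_eq_on_span[OF linear_id lin eq x[folded span]])
  then show ?thesis by simp
qed

text \<open>The inner product of \<open>S t\<close> with \<open>v n\<close> is
  \<open>t n * l $ n\<close>. As no \<open>l $ n\<close> vanishes, \<open>t\<close> is a unique
  coordinate vector, and the three claims become statements about the cube of all \<open>t\<close>
  with entries in [-1,1], its sign vectors, and the \<open>t\<close> whose entries all have absolute
  value at least 1.\<close>

lemma dual_basis_regions:
  fixes u v :: "'i::finite \<Rightarrow> 'a::euclidean_space" and l :: "real^'i"
  assumes dual: "is_dual_basis u v" and l: "\<And>n. l $ n \<noteq> 0"
  defines "S \<equiv> \<lambda>t. \<Sum>n\<in>UNIV. t n *\<^sub>R ((l $ n) *\<^sub>R u n)"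
  shows "parallelepiped v l = {S t | t. \<forall>n. \<bar>t n\<bar> \<le> 1}"
    and "p extreme_point_of parallelepiped v l \<longleftrightarrow> (\<exists>s. p = S s \<and> (\<forall>n. \<bar>s n\<bar> = 1))"
    and "outer_region v l =
      (\<Union>p \<in> {p. p extreme_point_of parallelepiped v l}. exterior_angle (parallelepiped v l) p)"
proof -
  have uv: "u m \<bullet> v n = (if m = n then 1 else 0)" for m n
    using dual by (auto simp: is_dual_basis_def)
  have in_span: "S t \<in> span (range v)" for t
  proof -
    have "S t \<in> span (range u)" unfolding S_def by (intro span_sum span_scale span_base) auto
    then show ?thesis using dual by (simp add: is_dual_basis_def)
  qed
  have inner: "S t \<bullet> v n = t n * l $ n" for t n
    by (simp add: S_def inner_sum_left uv if_distrib cong: if_cong)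
  have S_eq_iff: "S t = S s \<longleftrightarrow> t = s" for s t
  proof
    assume "S t = S s"
    then have "t n * l $ n = s n * l $ n" for n by (metis inner)
    then show "t = s" using l by (simp add: fun_eq_iff)
  qed simp
  have ex: "\<exists>t. x = S t" if "x \<in> span (range v)" for x
    using dual_basis_expansion[OF dual that] l
    by (intro exI[of _ "\<lambda>n. (x \<bullet> v n) / l $ n"]) (simp add: S_def)
  have P: "S t \<in> parallelepiped v l \<longleftrightarrow> (\<forall>n. \<bar>t n\<bar> \<le> 1)" for t
    using l by (simp add: parallelepiped_def in_span inner abs_mult)
  have O: "S t \<in> outer_region v l \<longleftrightarrow> (\<forall>n. \<bar>t n\<bar> \<ge> 1)" for t
    using l by (simp add: outer_region_def in_span inner abs_mult)
  show parallelepiped: "parallelepiped v l = {S t | t. \<forall>n. \<bar>t n\<bar> \<le> 1}"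
  proof (intro set_eqI iffI)
    fix x assume x: "x \<in> parallelepiped v l"
    then obtain t where "x = S t" using ex by (auto simp: parallelepiped_def)
    then show "x \<in> {S t | t. \<forall>n. \<bar>t n\<bar> \<le> 1}" using x P by blast
  qed (use P in blast)
  have comb: "a *\<^sub>R S s + b *\<^sub>R S t = S (\<lambda>n. a * s n + b * t n)" for a b s t
    by (simp add: S_def scaleR_sum_right sum.distrib[symmetric] scaleR_left_distrib distrib_right mult.assoc)
  show extreme: "p extreme_point_of parallelepiped v l \<longleftrightarrow> (\<exists>s. p = S s \<and> (\<forall>n. \<bar>s n\<bar> = 1))" for p
  proof
    assume p: "p extreme_point_of parallelepiped v l"
    then obtain t where t: "p = S t" "\<And>n. \<bar>t n\<bar> \<le> 1"
      by (auto simp: extreme_point_of_def parallelepiped)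
    have "\<bar>t k\<bar> = 1" for k
    proof (rule ccontr)
      assume "\<bar>t k\<bar> \<noteq> 1"
      with t(2)[of k] have k: "\<bar>t k\<bar> < 1" by simp
      \<comment> \<open>The largest step that keeps both \<open>t k - c\<close> and
        \<open>t k + c\<close> in [-1,1]; it is positive, so \<open>p\<close> is the midpoint of two
        distinct points of the body.\<close>
      define c where "c = 1 - \<bar>t k\<bar>"
      let ?a = "t(k := t k - c)" and ?b = "t(k := t k + c)"
      have "S ?a \<in> parallelepiped v l" "S ?b \<in> parallelepiped v l"
        unfolding P using t(2) k by (auto simp: c_def)
      moreover have "p = midpoint (S ?a) (S ?b)"
      proof -
        have "midpoint (S ?a) (S ?b) = (1/2) *\<^sub>R S ?a + (1/2) *\<^sub>R S ?b"
          by (simp add: midpoint_def scaleR_right_distrib)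
        also have "\<dots> = S t"
          unfolding comb S_eq_iff by (auto simp: fun_eq_iff field_simps)
        finally show ?thesis using t(1) by simp
      qed
      moreover have "S ?a \<noteq> S ?b"
        unfolding S_eq_iff using k by (auto simp: fun_eq_iff c_def dest: spec[of _ k])
      ultimately show False
        using p by (metis extreme_point_of_def midpoint_in_open_segment)
    qed
    then show "\<exists>s. p = S s \<and> (\<forall>n. \<bar>s n\<bar> = 1)" using t(1) by blast
  next
    assume "\<exists>s. p = S s \<and> (\<forall>n. \<bar>s n\<bar> = 1)"
    then obtain s where s: "p = S s" "\<And>n. \<bar>s n\<bar> = 1" by blast
    have "p \<notin> open_segment a b" if ab: "a \<in> parallelepiped v l" "b \<in> parallelepiped v l" for a b
    proof
      assume seg: "p \<in> open_segment a b"
      obtain \<alpha> \<beta> where \<alpha>: "a = S \<alpha>" "\<And>n. \<bar>\<alpha> n\<bar> \<le> 1" and \<beta>: "b = S \<beta>" "\<And>n. \<bar>\<beta> n\<bar> \<le> 1"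
        using ab unfolding parallelepiped by blast
      obtain w where w: "a \<noteq> b" "0 < w" "w < 1" "p = (1 - w) *\<^sub>R a + w *\<^sub>R b"
        using seg by (auto simp: in_segment)
      \<comment> \<open>A proper convex combination of two numbers in [-1,1] reaches 1 or -1 only if
        both numbers equal that value.\<close>
      have "(1 - w) * \<alpha> n = (1 - w) * s n \<and> w * \<beta> n = w * s n" for n
      proof -
        have s_eq: "s n = (1 - w) * \<alpha> n + w * \<beta> n"
          using w(4) unfolding s(1) \<alpha>(1) \<beta>(1) comb S_eq_iff by (simp add: fun_eq_iff)
        have "(1 - w) * \<alpha> n \<le> 1 - w" "- (1 - w) \<le> (1 - w) * \<alpha> n"
          "w * \<beta> n \<le> w" "- w \<le> w * \<beta> n"
          using \<alpha>(2)[of n] \<beta>(2)[of n] w(2,3)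
            mult_left_mono[of "\<alpha> n" 1 "1 - w"] mult_left_mono[of "-1" "\<alpha> n" "1 - w"]
            mult_left_mono[of "\<beta> n" 1 w] mult_left_mono[of "-1" "\<beta> n" w] by auto
        note * = s_eq this
        consider "s n = 1" | "s n = - 1" using s(2)[of n] by linarith
        then show ?thesis
        proof cases
          case 1
          with * have "(1 - w) * \<alpha> n = 1 - w" "w * \<beta> n = w" by linarith+
          then show ?thesis using 1 by simp
        next
          case 2
          with * have "(1 - w) * \<alpha> n = - (1 - w)" "w * \<beta> n = - w" by linarith+
          then show ?thesis using 2 by simp
        qed
      qed
      then have "\<alpha> = \<beta>" using w(2,3) by (simp add: fun_eq_iff)
      then show False using w(1) \<alpha>(1) \<beta>(1) by simp
    qed
    then show "p extreme_point_of parallelepiped v l"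
      using P[of s] s by (simp add: extreme_point_of_def)
  qed
  have ext: "S s + c *\<^sub>R (S s - S t) = S (\<lambda>n. s n + c * (s n - t n))" for s t c
    using comb[of "1 + c" s "- c" t] by (simp add: algebra_simps)
  show "outer_region v l =
      (\<Union>p \<in> {p. p extreme_point_of parallelepiped v l}. exterior_angle (parallelepiped v l) p)"
  proof (intro set_eqI iffI)
    fix x assume x: "x \<in> outer_region v l"
    then obtain t where t: "x = S t" using ex by (auto simp: outer_region_def)
    then have t1: "\<bar>t n\<bar> \<ge> 1" for n using x O by simp
    \<comment> \<open>The vertex \<open>s\<close> lies in the orthant of \<open>t\<close>. Solving
      \<open>t = s + c * (s - y)\<close> for \<open>y\<close> gives the formula below. One
      \<open>c\<close> must serve all coordinates, and the sum of the absolute values dominates each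
      of them, which keeps \<open>y\<close> in the cube.\<close>
    define s where "s n = sgn (t n)" for n
    define c where "c = (\<Sum>n\<in>UNIV. \<bar>t n\<bar>)"
    define y where "y n = s n * (1 - (\<bar>t n\<bar> - 1) / c)" for n
    have le: "\<bar>t n\<bar> \<le> c" for n unfolding c_def by (rule member_le_sum) auto
    have c: "c > 0" using le[of undefined] t1[of undefined] by linarith
    have s1: "\<bar>s n\<bar> = 1" for n using t1[of n] by (auto simp: s_def sgn_if)
    have "0 \<le> (\<bar>t n\<bar> - 1) / c \<and> (\<bar>t n\<bar> - 1) / c \<le> 1" for n
      using t1[of n] le[of n] c by (auto simp: divide_le_eq)
    moreover have "\<bar>y n\<bar> = \<bar>1 - (\<bar>t n\<bar> - 1) / c\<bar>" for n by (simp add: y_def abs_mult s1)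
    ultimately have "\<bar>y n\<bar> \<le> 1" for n by (simp add: abs_le_iff)
    then have yP: "S y \<in> parallelepiped v l" by (simp add: P)
    have "t n = s n + c * (s n - y n)" for n
    proof -
      have "c * (s n - y n) = s n * (\<bar>t n\<bar> - 1)" using c by (simp add: y_def field_simps)
      moreover have "s n * \<bar>t n\<bar> = t n" by (simp add: s_def sgn_mult_abs)
      ultimately show ?thesis by (simp add: right_diff_distrib)
    qed
    then have "x = S s + c *\<^sub>R (S s - S y)" unfolding ext t by (simp add: fun_eq_iff S_eq_iff)
    then have "x \<in> exterior_angle (parallelepiped v l) (S s)"
      using yP c unfolding exterior_angle_def by (auto intro: less_imp_le)
    moreover have "S s extreme_point_of parallelepiped v l" using extreme s1 by blast
    ultimately show "x \<in> (\<Union>p \<in> {p. p extreme_point_of parallelepiped v l}.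
        exterior_angle (parallelepiped v l) p)" by blast
  next
    fix x assume "x \<in> (\<Union>p \<in> {p. p extreme_point_of parallelepiped v l}.
        exterior_angle (parallelepiped v l) p)"
    then obtain p c y where p: "p extreme_point_of parallelepiped v l" and y: "y \<in> parallelepiped v l"
      and c: "c \<ge> 0" and x: "x = p + c *\<^sub>R (p - y)"
      by (auto simp: exterior_angle_def)
    from p obtain s where s: "p = S s" "\<And>n. \<bar>s n\<bar> = 1" using extreme by blast
    from y obtain t where t: "y = S t" "\<And>n. \<bar>t n\<bar> \<le> 1" unfolding parallelepiped by blast
    \<comment> \<open>The displacement \<open>c * (s n - t n)\<close> has the sign of
      \<open>s n\<close> or vanishes, so the absolute value cannot drop below 1.\<close>
    have "\<bar>s n + c * (s n - t n)\<bar> \<ge> 1" for n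
    proof (cases "s n = 1")
      case True
      then have "c * (s n - t n) \<ge> 0" using c t(2)[of n] by (intro mult_nonneg_nonneg) auto
      then show ?thesis using True by simp
    next
      case False
      then have "s n = - 1" using s(2)[of n] by linarith
      moreover from this have "c * (s n - t n) \<le> 0"
        using c t(2)[of n] by (intro mult_nonneg_nonpos) auto
      ultimately show ?thesis by simp
    qed
    then show "x \<in> outer_region v l" unfolding x s(1) t(1) ext O by blast
  qed
qed

subsection \<open>Integration over the radius\<close>

text \<open>The normalisation of the radial computation: \<open>3 / t\<close> stems from the ratio
  of base area to cone volume, and the remaining power of \<open>t\<close> from scaling volume in
  dimension 3.\<close>

lemma nn_integral_3_powr_minus_4:
  "(\<integral>\<^sup>+ t. ennreal (3 / t ^ 4) * indicator {1..} t \<partial>lborel) = 1"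
proof -
  have "((\<lambda>t :: real. - (1 / t ^ 3)) \<longlongrightarrow> - 0) at_top"
    by (intro tendsto_minus tendsto_divide_0[OF tendsto_const] filterlim_at_top_imp_at_infinity
          filterlim_pow_at_top filterlim_ident) simp
  then have "(\<integral>\<^sup>+ t. ennreal (3 / t ^ 4) * indicator {1..} t \<partial>lborel) = ennreal (0 - (- (1 / 1 ^ 3)))"
    by (intro nn_integral_FTC_atLeast)
       (auto intro!: derivative_eq_intros simp: power_eq_if)
  then show ?thesis by simp
qed

lemma nn_integral_lborel_scale:
  fixes f :: "'a::euclidean_space \<Rightarrow> ennreal"
  assumes [measurable]: "f \<in> borel_measurable borel" and c: "c > 0"
  shows "(\<integral>\<^sup>+ x. f (c *\<^sub>R x) \<partial>lborel) = ennreal (1 / c ^ DIM('a)) * (\<integral>\<^sup>+ x. f x \<partial>lborel)"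
proof -
  have "(\<integral>\<^sup>+ x. f x \<partial>lborel) = (\<integral>\<^sup>+ x. f x \<partial>density (distr lborel borel (\<lambda>x. 0 + c *\<^sub>R x)) (\<lambda>_. ennreal (\<bar>c\<bar> ^ DIM('a))))"
    using c by (subst lborel_affine[of c "0::'a"]) auto
  also have "\<dots> = ennreal (c ^ DIM('a)) * (\<integral>\<^sup>+ x. f (c *\<^sub>R x) \<partial>lborel)"
    using c by (simp add: nn_integral_density nn_integral_distr nn_integral_cmult)
  finally show ?thesis
    using c by (simp add: mult.assoc[symmetric] ennreal_mult[symmetric])
qed

text \<open>Polar integration without surface measure. The set on the left is the solid cone over
  the part of the sphere of radius \<rho> inside \<open>Q\<close>, and its volume times
  \<open>3 / \<rho>\<close> is the area of that part in the sense of
  \<open>sphere_area\<close>.\<close>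

lemma nn_integral_radial_section:
  fixes Q :: "(real^3) set" and g :: "real \<Rightarrow> real"
  assumes [measurable]: "Q \<in> sets borel" "g \<in> borel_measurable borel" and g: "\<And>\<rho>. g \<rho> \<ge> 0"
  shows "(\<integral>\<^sup>+ \<rho>. ennreal (3 * g \<rho> / \<rho>) *
      emeasure lborel {y. 0 < norm y \<and> norm y \<le> \<rho> \<and> (\<rho> / norm y) *\<^sub>R y \<in> Q} \<partial>lborel) =
    (\<integral>\<^sup>+ x. ennreal (g (norm x)) * indicator Q x \<partial>lborel)"
proof -
  define A where "A \<rho> = {y :: real^3. 0 < norm y \<and> norm y \<le> \<rho> \<and> (\<rho> / norm y) *\<^sub>R y \<in> Q}" for \<rho>
  have [measurable]: "(\<lambda>p. indicator (A (fst p)) (snd p) :: ennreal) \<in> borel_measurable (borel \<Otimes>\<^sub>M borel)"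
  proof -
    have "{p \<in> space (borel \<Otimes>\<^sub>M borel). 0 < norm (snd p) \<and> norm (snd p) \<le> fst p \<and>
        (fst p / norm (snd p)) *\<^sub>R (snd p :: real^3) \<in> Q} \<in> sets (borel \<Otimes>\<^sub>M borel)"
      by measurable
    then have "indicator {p. 0 < norm (snd p) \<and> norm (snd p) \<le> fst p \<and>
        (fst p / norm (snd p)) *\<^sub>R (snd p :: real^3) \<in> Q} \<in> borel_measurable ((borel :: real measure) \<Otimes>\<^sub>M (borel :: (real^3) measure))"
      by (intro borel_measurable_indicator) (simp add: space_pair_measure)
    then show ?thesis
      by (rule measurable_cong[THEN iffD1, rotated]) (auto simp: A_def indicator_def)
  qed
  have [measurable]: "A \<rho> \<in> sets borel" for \<rho> unfolding A_def by measurable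
  let ?\<phi> = "\<lambda>x. ennreal (g (norm x)) * indicator Q x"
  \<comment> \<open>For fixed \<open>y\<close> substitute \<open>\<rho> = t * norm y\<close>, then for fixed \<open>t\<close> substitute \<open>x = t *\<^sub>R y\<close>; the
    remaining integral over \<open>t \<ge> 1\<close> is \<open>1\<close>.\<close>
  have "(\<integral>\<^sup>+ \<rho>. ennreal (3 * g \<rho> / \<rho>) * emeasure lborel (A \<rho>) \<partial>lborel) =
      (\<integral>\<^sup>+ \<rho>. \<integral>\<^sup>+ y. ennreal (3 * g \<rho> / \<rho>) * indicator (A \<rho>) y \<partial>lborel \<partial>lborel)"
    by (rule nn_integral_cong) (simp add: nn_integral_cmult)
  also have "\<dots> = (\<integral>\<^sup>+ y. \<integral>\<^sup>+ \<rho>. ennreal (3 * g \<rho> / \<rho>) * indicator (A \<rho>) y \<partial>lborel \<partial>lborel)"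
    by (rule lborel_pair.Fubini'[symmetric]) (simp add: case_prod_unfold)
  also have "\<dots> = (\<integral>\<^sup>+ y. \<integral>\<^sup>+ t. ennreal (3 / t) * indicator {1..} t * ?\<phi> (t *\<^sub>R y) \<partial>lborel \<partial>lborel)"
  proof (rule nn_integral_cong_AE)
    \<comment> \<open>The origin is excluded because the substitution scales by
      \<open>norm y\<close>.\<close>
    show "AE y in lborel. (\<integral>\<^sup>+ \<rho>. ennreal (3 * g \<rho> / \<rho>) * indicator (A \<rho>) y \<partial>lborel) =
      (\<integral>\<^sup>+ t. ennreal (3 / t) * indicator {1..} t * ?\<phi> (t *\<^sub>R y) \<partial>lborel)"
      using AE_lborel_singleton[of 0]
    proof eventually_elim
      fix y :: "real^3" assume y: "y \<noteq> 0"
      have "(\<lambda>\<rho>. indicator (A \<rho>) y :: ennreal) = (\<lambda>\<rho>. (\<lambda>p. indicator (A (fst p)) (snd p)) (\<rho>, y))"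
        by simp
      also have "\<dots> \<in> borel_measurable borel" by measurable
      finally have [measurable]: "(\<lambda>\<rho>. indicator (A \<rho>) y :: ennreal) \<in> borel_measurable borel" .
      have "(\<integral>\<^sup>+ \<rho>. ennreal (3 * g \<rho> / \<rho>) * indicator (A \<rho>) y \<partial>lborel) =
        ennreal \<bar>norm y\<bar> * (\<integral>\<^sup>+ t. ennreal (3 * g (0 + norm y * t) / (0 + norm y * t)) * indicator (A (0 + norm y * t)) y \<partial>lborel)"
        using y by (intro nn_integral_real_affine) auto
      also have "\<dots> = (\<integral>\<^sup>+ t. ennreal (norm y) * (ennreal (3 * g (norm y * t) / (norm y * t)) * indicator (A (norm y * t)) y) \<partial>lborel)"
        by (subst nn_integral_cmult) auto
      also have "\<dots> = (\<integral>\<^sup>+ t. ennreal (3 / t) * indicator {1..} t * ?\<phi> (t *\<^sub>R y) \<partial>lborel)"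
      proof (rule nn_integral_cong)
        fix t :: real
        have "y \<in> A (norm y * t) \<longleftrightarrow> 1 \<le> t \<and> t *\<^sub>R y \<in> Q"
          using y by (auto simp: A_def)
        then show "ennreal (norm y) * (ennreal (3 * g (norm y * t) / (norm y * t)) * indicator (A (norm y * t)) y) =
            ennreal (3 / t) * indicator {1..} t * ?\<phi> (t *\<^sub>R y)"
          using y g by (auto simp: indicator_def ennreal_mult[symmetric] field_simps)
      qed
      finally show "(\<integral>\<^sup>+ \<rho>. ennreal (3 * g \<rho> / \<rho>) * indicator (A \<rho>) y \<partial>lborel) = \<dots>" .
    qed
  qed
  also have "\<dots> = (\<integral>\<^sup>+ t. \<integral>\<^sup>+ y. ennreal (3 / t) * indicator {1..} t * ?\<phi> (t *\<^sub>R y) \<partial>lborel \<partial>lborel)"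
    by (rule lborel_pair.Fubini') measurable
  also have "\<dots> = (\<integral>\<^sup>+ t. ennreal (3 / t ^ 4) * indicator {1..} t * (\<integral>\<^sup>+ x. ?\<phi> x \<partial>lborel) \<partial>lborel)"
  proof (rule nn_integral_cong)
    fix t :: real
    show "(\<integral>\<^sup>+ y. ennreal (3 / t) * indicator {1..} t * ?\<phi> (t *\<^sub>R y) \<partial>lborel) =
      ennreal (3 / t ^ 4) * indicator {1..} t * (\<integral>\<^sup>+ x. ?\<phi> x \<partial>lborel)"
    proof (cases "t \<ge> 1")
      case True
      have "(\<integral>\<^sup>+ y. ennreal (3 / t) * indicator {1..} t * ?\<phi> (t *\<^sub>R y) \<partial>lborel) =
          ennreal (3 / t) * (\<integral>\<^sup>+ y. ?\<phi> (t *\<^sub>R y) \<partial>lborel)"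
        using True by (subst nn_integral_cmult[symmetric]) auto
      also have "\<dots> = ennreal (3 / t) * (ennreal (1 / t ^ DIM(real^3)) * (\<integral>\<^sup>+ x. ?\<phi> x \<partial>lborel))"
        using True by (subst nn_integral_lborel_scale[of ?\<phi> t]) auto
      also have "\<dots> = ennreal (3 / t ^ 4) * (\<integral>\<^sup>+ x. ?\<phi> x \<partial>lborel)"
        using True by (simp add: mult.assoc[symmetric] ennreal_mult[symmetric] power_eq_if)
      finally show ?thesis using True by simp
    qed simp
  qed
  also have "\<dots> = (\<integral>\<^sup>+ t. ennreal (3 / t ^ 4) * indicator {1..} t \<partial>lborel) * (\<integral>\<^sup>+ x. ?\<phi> x \<partial>lborel)"
    by (rule nn_integral_multc) measurable
  finally show ?thesis unfolding nn_integral_3_powr_minus_4 A_def by simp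
qed

text \<open>The factor \<open>DIM / \<rho>\<close> of \<open>sphere_area\<close> cancels in the
  quotient, and the cone over the full sphere is the ball without its centre.\<close>

lemma sphere_proportion_eq:
  fixes e :: "3 \<Rightarrow> 'a::real_inner"
  assumes \<rho>: "\<rho> > 0"
  shows "sphere_proportion e S \<rho> =
    measure lborel {y :: real^3. 0 < norm y \<and> norm y \<le> \<rho> \<and> from_coords e ((\<rho> / norm y) *\<^sub>R y) \<in> S} /
      (4 / 3 * pi * \<rho> ^ 3)"
proof -
  \<comment> \<open>A point \<open>y\<close> of the cone determines its base point
    \<open>(\<rho> / norm y) *\<^sub>R y\<close> and its height parameter
    \<open>norm y / \<rho>\<close>.\<close>
  have cone: "{t *\<^sub>R x | t x. 0 < t \<and> t \<le> 1 \<and> x \<in> {x \<in> sphere 0 \<rho>. R x}} =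
      {y :: real^3. 0 < norm y \<and> norm y \<le> \<rho> \<and> R ((\<rho> / norm y) *\<^sub>R y)}" for R
  proof (intro set_eqI iffI)
    fix y assume "y \<in> {t *\<^sub>R x | t x. 0 < t \<and> t \<le> 1 \<and> x \<in> {x \<in> sphere 0 \<rho>. R x}}"
    then obtain t x where y: "y = t *\<^sub>R x" "0 < t" "t \<le> 1" "norm x = \<rho>" "R x" by auto
    then have "x \<noteq> 0" using \<rho> by (metis norm_zero less_irrefl)
    then have "norm y = t * \<rho>" "(\<rho> / norm y) *\<^sub>R y = x" using y by auto
    moreover have "0 < t * \<rho>" "t * \<rho> \<le> \<rho>"
      using y(2,3) \<rho> by (simp_all add: mult_left_le_one_le)
    ultimately show "y \<in> {y. 0 < norm y \<and> norm y \<le> \<rho> \<and> R ((\<rho> / norm y) *\<^sub>R y)}"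
      using y(5) by (simp only: mem_Collect_eq)
  next
    fix y assume "y \<in> {y :: real^3. 0 < norm y \<and> norm y \<le> \<rho> \<and> R ((\<rho> / norm y) *\<^sub>R y)}"
    then have y: "0 < norm y" "norm y \<le> \<rho>" "R ((\<rho> / norm y) *\<^sub>R y)" by auto
    show "y \<in> {t *\<^sub>R x | t x. 0 < t \<and> t \<le> 1 \<and> x \<in> {x \<in> sphere 0 \<rho>. R x}}"
      using y \<rho>
      by (intro CollectI exI[of _ "norm y / \<rho>"] exI[of _ "(\<rho> / norm y) *\<^sub>R y"]) auto
  qed
  have "{t *\<^sub>R x | t x. 0 < t \<and> t \<le> 1 \<and> x \<in> sphere (0 :: real^3) \<rho>} = cball 0 \<rho> - {0}"
    using cone[of "\<lambda>_. True"] by auto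
  then have "measure lborel {t *\<^sub>R x | t x. 0 < t \<and> t \<le> 1 \<and> x \<in> sphere (0 :: real^3) \<rho>} =
      measure lborel (cball (0 :: real^3) \<rho>)"
    by (simp only: measure_Diff_null_set finite_imp_null_set_lborel finite.intros sets_lborel borel_closed closed_cball)
  also have "\<dots> = 4 / 3 * pi * \<rho> ^ 3"
    using \<rho> content_cball[of \<rho> "0 :: real^3"] unit_ball_vol_3 by simp
  finally have ball: "measure lborel {t *\<^sub>R x | t x. 0 < t \<and> t \<le> 1 \<and> x \<in> sphere (0 :: real^3) \<rho>} =
      4 / 3 * pi * \<rho> ^ 3" .
  show ?thesis
    using \<rho> unfolding sphere_proportion_def sphere_area_def cone ball by simp
qed

text \<open>The function \<open>f\<close> is an arbitrary version of the density, and densities are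
  unique only up to null sets. The explicit version is sphere area times the Gaussian density at
  that radius.\<close>

lemma gaussian_length_density_AE_eq:
  assumes "is_gaussian_length_density TYPE(3) f"
  shows "AE \<rho> in lborel. f \<rho> = indicator {0..} \<rho> * (4 * pi * \<rho>\<^sup>2) * (exp (- \<rho>\<^sup>2 / 2) / sqrt (2 * pi) ^ 3)"
proof -
  define g where "g \<rho> = exp (- \<rho>\<^sup>2 / 2) / sqrt (2 * pi) ^ 3" for \<rho> :: real
  define f0 where "f0 \<rho> = indicator {0..} \<rho> * (4 * pi * \<rho>\<^sup>2) * g \<rho>" for \<rho> :: real
  have g0: "0 \<le> g \<rho>" for \<rho> by (simp add: g_def)
  have [measurable]: "g \<in> borel_measurable borel" unfolding g_def by measurable
  have [measurable]: "f0 \<in> borel_measurable borel" unfolding f0_def by measurable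
  have f: "0 \<le> f \<rho>" "distributed (std_gaussian :: (real^3) measure) lborel norm (\<lambda>\<rho>. ennreal (f \<rho>))" for \<rho>
    using assms by (auto simp: is_gaussian_length_density_def)
  have "density lborel (\<lambda>\<rho>. ennreal (f \<rho>)) = distr (std_gaussian :: (real^3) measure) lborel norm"
    by (rule distributed_distr_eq_density[OF f(2), symmetric])
  also have "\<dots> = distr (std_gaussian :: (real^3) measure) borel norm"
    by (rule distr_cong) auto
  also have "\<dots> = density (distr (lborel :: (real^3) measure) borel norm) (\<lambda>\<rho>. ennreal (g \<rho>))"
    by (subst density_distr) (auto simp: std_gaussian_norm g_def)
  also have "\<dots> = density lborel (\<lambda>\<rho>. ennreal (f0 \<rho>))"
    unfolding distr_lborel_norm_3
    by (subst density_density_eq)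
       (auto intro!: arg_cong[where f="density lborel"] simp: f0_def ennreal_mult[symmetric] g0)
  finally have "AE \<rho> in lborel. ennreal (f \<rho>) = ennreal (f0 \<rho>)"
    using distributed_borel_measurable[OF f(2)] by (intro sigma_finite_measure.density_unique[OF sigma_finite_lborel]) auto
  then show ?thesis
    using f(1) g0 by (auto simp: f0_def g_def)
qed

lemma gaussian_mass_polar:
  fixes e :: "3 \<Rightarrow> 'a::euclidean_space"
  assumes S: "S \<in> sets borel" and f: "is_gaussian_length_density TYPE(3) f"
  shows "measure (span_gaussian e) S = (LBINT \<rho>=0..\<infinity>. sphere_proportion e S \<rho> * f \<rho>)"
proof -
  define g where "g \<rho> = exp (- \<rho>\<^sup>2 / 2) / sqrt (2 * pi) ^ 3" for \<rho> :: real
  have g0: "0 \<le> g \<rho>" for \<rho> by (simp add: g_def)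
  have [measurable]: "g \<in> borel_measurable borel" unfolding g_def by measurable
  define Q where "Q = {x. from_coords e x \<in> S}"
  have fc: "from_coords e \<in> borel_measurable borel"
    by (rule borel_measurable_linear[OF linear_from_coords])
  have Q[measurable]: "Q \<in> sets borel"
    using measurable_sets[OF fc S] by (simp add: Q_def vimage_def)
  define A where "A \<rho> = {y :: real^3. 0 < norm y \<and> norm y \<le> \<rho> \<and> (\<rho> / norm y) *\<^sub>R y \<in> Q}" for \<rho>
  \<comment> \<open>The proportion has denominator \<open>4 / 3 * pi * \<rho> ^ 3\<close> and the
    length density has the factor \<open>4 * pi * \<rho>\<^sup>2\<close>; their quotient is the
    \<open>3 / \<rho>\<close> seen here, which is the weight in
    \<open>nn_integral_radial_section\<close>.\<close>
  define K where "K \<rho> = indicator {0<..} \<rho> * (3 * g \<rho> / \<rho> * measure lborel (A \<rho>))" for \<rho>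
  have K0: "K \<rho> \<ge> 0" for \<rho> by (auto simp: K_def g0 indicator_def)
  have Ameas: "A \<rho> \<in> sets borel" for \<rho> unfolding A_def by measurable
  have Afin: "emeasure lborel (A \<rho>) = ennreal (measure lborel (A \<rho>))" for \<rho>
  proof (rule emeasure_eq_ennreal_measure)
    have "emeasure lborel (A \<rho>) \<le> emeasure lborel (cball (0 :: real^3) \<rho>)"
      by (rule emeasure_mono) (auto simp: A_def)
    also have "\<dots> < \<infinity>" by (rule emeasure_lborel_cball_finite)
    finally show "emeasure lborel (A \<rho>) \<noteq> top" by simp
  qed
  have Am: "(\<lambda>\<rho>. measure lborel (A \<rho>)) \<in> borel_measurable borel"
  proof -
    have "(\<lambda>\<rho>. emeasure lborel (A \<rho>)) \<in> borel_measurable borel"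
    proof (rule lborel.measurable_emeasure)
      have "{p \<in> space (borel \<Otimes>\<^sub>M borel). 0 < norm (snd p) \<and> norm (snd p) \<le> fst p \<and>
          (fst p / norm (snd p)) *\<^sub>R (snd p :: real^3) \<in> Q} \<in> sets (borel \<Otimes>\<^sub>M borel)"
        by measurable
      then show "{p \<in> space (borel \<Otimes>\<^sub>M lborel). snd p \<in> A (fst p)} \<in> sets (borel \<Otimes>\<^sub>M lborel)"
        by (simp add: A_def space_pair_measure cong: sets_pair_measure_cong)
    qed simp
    then show ?thesis unfolding measure_def by measurable
  qed
  then have [measurable]: "K \<in> borel_measurable borel" unfolding K_def by measurable
  have AK: "ennreal (3 * g \<rho> / \<rho>) * emeasure lborel (A \<rho>) = ennreal (K \<rho>)" for \<rho>
  proof (cases "\<rho> > 0")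
    case True
    then show ?thesis by (simp add: Afin K_def ennreal_mult[symmetric] g0)
  next
    \<comment> \<open>For nonpositive radii the cone is empty, which agrees with the indicator in
      \<open>K\<close>.\<close>
    case False
    then have "\<not> (0 < norm y \<and> norm y \<le> \<rho>)" for y :: "real^3" by linarith
    then have "A \<rho> = {}" by (auto simp: A_def)
    then show ?thesis using False by (simp add: K_def)
  qed
  have AE: "AE \<rho> in lborel. indicator (einterval 0 \<infinity>) \<rho> *\<^sub>R (sphere_proportion e S \<rho> * f \<rho>) = K \<rho>"
    using gaussian_length_density_AE_eq[OF f]
  proof eventually_elim
    case (elim \<rho>)
    show ?case
    proof (cases "\<rho> > 0")
      case True
      have "sphere_proportion e S \<rho> = measure lborel (A \<rho>) / (4 / 3 * pi * \<rho> ^ 3)"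
        using True by (simp add: sphere_proportion_eq A_def Q_def)
      moreover have "f \<rho> = 4 * pi * \<rho>\<^sup>2 * g \<rho>"
        using elim True by (simp add: g_def)
      ultimately show ?thesis
        using True by (simp add: K_def einterval_def power2_eq_square power3_eq_cube field_simps)
    next
      case False
      then show ?thesis by (simp add: K_def einterval_def)
    qed
  qed
  have "ennreal (measure (span_gaussian e) S) = emeasure (std_gaussian :: (real^3) measure) Q"
  proof -
    have "from_coords e \<in> measurable std_gaussian borel" using fc by simp
    from measure_distr[OF this S] show ?thesis
      by (simp add: span_gaussian_def Q_def vimage_def emeasure_std_gaussian_eq)
  qed
  also have "\<dots> = (\<integral>\<^sup>+ x. ennreal (g (norm x)) * indicator Q x \<partial>lborel)"
    unfolding std_gaussian_norm using Q by (subst emeasure_density) (auto simp: g_def)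
  also have "\<dots> = (\<integral>\<^sup>+ \<rho>. ennreal (K \<rho>) \<partial>lborel)"
    using nn_integral_radial_section[of Q g] g0 unfolding A_def[symmetric] AK by simp
  finally have nn: "(\<integral>\<^sup>+ \<rho>. ennreal (K \<rho>) \<partial>lborel) = ennreal (measure (span_gaussian e) S)" by simp
  have "(LBINT \<rho>=0..\<infinity>. sphere_proportion e S \<rho> * f \<rho>) =
      (\<integral>\<rho>. indicator (einterval 0 \<infinity>) \<rho> *\<^sub>R (sphere_proportion e S \<rho> * f \<rho>) \<partial>lborel)"
    by (simp add: interval_lebesgue_integral_def set_lebesgue_integral_def)
  also have "\<dots> = (\<integral>\<rho>. K \<rho> \<partial>lborel)"
  proof (rule integral_cong_AE)
    have [measurable]: "f \<in> borel_measurable borel"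
      using f distributed_real_measurable[where f = f and N = lborel]
      by (auto simp: is_gaussian_length_density_def)
    \<comment> \<open>The volume formula for the proportion is available only for positive radii;
      the indicator restricts the integrand to these before measurability is shown.\<close>
    have "(\<lambda>\<rho>. indicator {0<..} \<rho> * (measure lborel (A \<rho>) / (4 / 3 * pi * \<rho> ^ 3) * f \<rho>)) \<in> borel_measurable lborel"
      using Am by measurable
    also have "(\<lambda>\<rho>. indicator {0<..} \<rho> * (measure lborel (A \<rho>) / (4 / 3 * pi * \<rho> ^ 3) * f \<rho>)) =
        (\<lambda>\<rho>. indicator (einterval 0 \<infinity>) \<rho> *\<^sub>R (sphere_proportion e S \<rho> * f \<rho>))"
      by (auto simp: fun_eq_iff indicator_def einterval_def sphere_proportion_eq A_def Q_def)
    finally show "(\<lambda>\<rho>. indicator (einterval 0 \<infinity>) \<rho> *\<^sub>R (sphere_proportion e S \<rho> * f \<rho>)) \<in> borel_measurable lborel" .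
  qed (use AE in auto)
  also have "\<dots> = measure (span_gaussian e) S"
    using K0 by (subst integral_eq_nn_integral) (auto simp: nn)
  finally show ?thesis by simp
qed

section \<open>The collision probability and the geometry of the Gaussian mass\<close>

theorem theorem1:
  fixes v :: "3 \<Rightarrow> real^'d"
    and e :: "3 \<Rightarrow> real^'d"
    and b :: "'d \<Rightarrow> real^'d"
    and M :: "'w measure"
    and r :: "nat \<Rightarrow> 'w \<Rightarrow> real^'d"
    and h :: nat
  assumes "CARD('d) \<ge> 3" and "h \<ge> 2"
    and "inj v" and "independent (range v)" and "\<forall>n. norm (v n) = 1"
    and "orthonormal_basis_of e (span (range v))"
    and "prob_space M"
    and "orthonormal_basis_of b UNIV"
    and "prob_space.indep_vars M (\<lambda>_. borel) (\<lambda>(i, c) \<omega>. r i \<omega> \<bullet> b c) ({1..h} \<times> UNIV)"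
    and "\<forall>i\<in>{1..h}. \<forall>c. distributed M lborel (\<lambda>\<omega>. r i \<omega> \<bullet> b c) std_normal_density"
  defines "H \<equiv> \<lambda>\<omega>. rp_hash (\<lambda>i. r i \<omega>) (h - 1) 1"
    and "G \<equiv> \<lambda>l1 l2 l3. gaussian_mass e v (vector [l1, l2, l3])"
    and "q \<equiv> \<lambda>l1 l2 l3. quad_form (matrix_inv (gram_matrix v)) (vector [l1, l2, l3])"
  shows "integrable lborel (\<lambda>(l1, l2, l3). G l1 l2 l3 ^ (h - 1) * exp (- q l1 l2 l3 / 2))
    \<and> measure M {\<omega> \<in> space M. H \<omega> (v 1) = H \<omega> (v 2) \<and> H \<omega> (v 2) = H \<omega> (v 3)} =
        real h / (\<bar>scalar_triple_product e v\<bar> * (2 * pi) powr (3 / 2)) *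
        (\<integral>l3. (\<integral>l2. (\<integral>l1. G l1 l2 l3 ^ (h - 1) * exp (- q l1 l2 l3 / 2)
          \<partial>lborel) \<partial>lborel) \<partial>lborel)
    \<and> (\<forall>u l. is_dual_basis u v \<longrightarrow> (\<forall>n. l $ n \<noteq> 0) \<longrightarrow>
        parallelepiped v l =
          {\<Sum>n\<in>UNIV. t n *\<^sub>R ((l $ n) *\<^sub>R u n) | t. \<forall>n. \<bar>t n\<bar> \<le> 1} \<and>
        outer_region v l =
          (\<Union>p \<in> {p. p extreme_point_of parallelepiped v l}.
             exterior_angle (parallelepiped v l) p))
    \<and> (\<forall>f3 l1 l2 l3. is_gaussian_length_density TYPE(3) f3 \<longrightarrow>
        G l1 l2 l3 =
          (LBINT \<rho>=0..\<infinity>.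
             sphere_proportion e (outer_region v (vector [l1, l2, l3])) \<rho> * f3 \<rho>))"
proof -
  interpret prob_space M by fact
  have e: "orthonormal e" and span: "span (range e) = span (range v)" and b: "orthonormal b"
    using assms(6,8) by (auto simp: orthonormal_basis_of_def orthonormal_def)
  define F where "F l = gaussian_mass e v l ^ (h - 1) * exp (- quad_form (matrix_inv (gram_matrix v)) l / 2)"
    for l
  define D where "D = \<bar>scalar_triple_product e v\<bar>"
  have F: "integrable lborel F"
    unfolding F_def by (rule gaussian_mass_power_expectation(1)[OF e span])
  have FG: "G l1 l2 l3 ^ (h - 1) * exp (- q l1 l2 l3 / 2) = F (vector [l1, l2, l3])" for l1 l2 l3
    by (simp add: F_def G_def q_def)
  define W where "W i \<omega> = coords e (r i \<omega>)" for i \<omega>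
  \<comment> \<open>Nonzero directions are what makes ties null events.\<close>
  have a: "coords e (v n) \<noteq> 0" for n
  proof
    assume "coords e (v n) = 0"
    then have "from_coords e (coords e (v n)) = 0" by (simp add: from_coords_def)
    moreover have "v n \<in> span (range e)" unfolding span by (simp add: span_base)
    ultimately have "v n = 0" using from_coords_coords[OF e] by simp
    then show False using assms(5) by (metis norm_zero zero_neq_one)
  qed
  \<comment> \<open>Each \<open>v n\<close> lies in the span of \<open>e\<close>, so its inner
    product with \<open>r i\<close> sees only the projection of \<open>r i\<close>, whose
    coordinates are \<open>W i\<close>.\<close>
  have rv: "r i \<omega> \<bullet> v n = W i \<omega> \<bullet> coords e (v n)" for i \<omega> n
  proof -
    have "from_coords e (coords e (v n)) = v n"
      using from_coords_coords[OF e] unfolding span by (simp add: span_base)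
    then show ?thesis
      by (metis W_def from_coords_inner inner_commute)
  qed
  have beats: "beats (\<lambda>i. r i \<omega>) (v n) = beats (\<lambda>i. W i \<omega>) (coords e (v n))" for \<omega> n
    by (simp add: beats_def fun_eq_iff rv)
  have "{\<omega> \<in> space M. H \<omega> (v 1) = H \<omega> (v 2) \<and> H \<omega> (v 2) = H \<omega> (v 3)} =
    {\<omega> \<in> space M. \<exists>j\<in>{1..h}. \<forall>n. \<forall>i\<in>{1..h} - {j}. beats (\<lambda>i. W i \<omega>) (coords e (v n)) i j}"
    unfolding H_def using assms(2) by (simp only: three_way_collision_iff[of h] beats)
  moreover have "emeasure M \<dots> = of_nat h * ennreal ((\<integral>l. F l \<partial>lborel) / (D * sqrt (2 * pi) ^ 3))"
  proof -
    note W = coords_of_gaussian_family[OF e b assms(9), folded W_def]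
    have "emeasure M {\<omega> \<in> space M. \<exists>j\<in>{1..h}. \<forall>n. \<forall>i\<in>{1..h} - {j}. beats (\<lambda>i. W i \<omega>) (coords e (v n)) i j} =
      of_nat h * (\<integral>\<^sup>+ w. emeasure std_gaussian {y. \<forall>n. \<bar>w \<bullet> coords e (v n)\<bar> \<le> \<bar>y \<bullet> coords e (v n)\<bar>} ^ (h - 1) \<partial>std_gaussian)"
      using assms(2,10) a by (intro emeasure_common_loser W) auto
    also have "\<dots> = of_nat h * ennreal ((\<integral>l. F l \<partial>lborel) / (D * sqrt (2 * pi) ^ CARD(3)))"
      unfolding F_def D_def scalar_triple_product_det
      by (subst gaussian_mass_power_expectation(2)[OF e span]) (rule refl)
    finally show ?thesis by simp
  qed
  ultimately have "measure M {\<omega> \<in> space M. H \<omega> (v 1) = H \<omega> (v 2) \<and> H \<omega> (v 2) = H \<omega> (v 3)} =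
      enn2real (of_nat h * ennreal ((\<integral>l. F l \<partial>lborel) / (D * sqrt (2 * pi) ^ 3)))"
    by (simp add: measure_def)
  also have "\<dots> = real h * ((\<integral>l. F l \<partial>lborel) / (D * sqrt (2 * pi) ^ 3))"
  proof -
    have "(\<integral>l. F l \<partial>lborel) \<ge> 0" by (rule Bochner_Integration.integral_nonneg) (simp add: F_def gaussian_mass_def)
    then show ?thesis by (simp add: enn2real_mult D_def)
  qed
  also have "sqrt (2 * pi) ^ 3 = (2 * pi) powr (3 / 2)"
  proof -
    have "(2 * pi) powr (3 / 2) = ((2 * pi) powr (1 / 2)) powr 3" by (simp add: powr_powr)
    also have "\<dots> = sqrt (2 * pi) ^ 3" by (simp add: powr_half_sqrt powr_numeral)
    finally show ?thesis ..
  qed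
  finally have prob: "measure M {\<omega> \<in> space M. H \<omega> (v 1) = H \<omega> (v 2) \<and> H \<omega> (v 2) = H \<omega> (v 3)} =
      real h / (D * (2 * pi) powr (3 / 2)) * (\<integral>l. F l \<partial>lborel)"
    by simp
  have "G l1 l2 l3 =
      (LBINT \<rho>=0..\<infinity>. sphere_proportion e (outer_region v (vector [l1, l2, l3])) \<rho> * f3 \<rho>)"
    if "is_gaussian_length_density TYPE(3) f3" for f3 l1 l2 l3
    unfolding G_def gaussian_mass_def
    by (rule gaussian_mass_polar[OF borel_closed[OF outer_region_closed] that])
  then show ?thesis
    unfolding FG
    using integral_vector3[OF F] prob dual_basis_regions(1,3)[of _ v] by (simp add: D_def)
qed

end
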